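(* Let $c$ be a structured-decomposable orthonormal circuit over a finite set of variables $\mathbf{X}$. Let $\mathbf{Z}\subseteq\mathbf{X}$ and $\mathbf{Y}=\mathbf{X}\setminus\mathbf{Z}$. Then, given an assignment $\mathbf{y}\in\mathrm{dom}(\mathbf{Y})$, the marginal likelihood $$p(\mathbf{y})=\int_{\mathrm{dom}(\mathbf{Z})}|c(\mathbf{y},\mathbf{z})|^2\,\mathrm{d}\mathbf{z}$$ can be computed in time $\mathcal{O}\big(|\phi_{\mathbf{Y}}|\,S+|\phi_{\mathbf{Y},\mathbf{Z}}|\,S^2\big)$, where $\phi_{\mathbf{Y}}$ denotes the set of layers of $c$ whose scope contains only variables in $\mathbf{Y}$, $\phi_{\mathbf{Y},\mathbf{Z}}$ denotes the set of layers of $c$ whose scope contains both variables in $\mathbf{Y}$ and variables in $\mathbf{Z}$, and $S$ is the maximum size of a layer of $c$.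
   Context: Variables: $\mathbf{X}=\{X_i\}_{i=1}^d$ is a finite set of variables, each with a domain $\mathrm{dom}(X_i)$; for a subset of variables, $\mathrm{dom}$ denotes the product of the domains. Integrals over the domain of a continuous variable are with respect to Lebesgue measure; for discrete variables they are sums (counting measure). $[n]=\{1,\dots,n\}$; $(\cdot)^*$ is complex conjugation; $(\cdot)^\dagger$ is the conjugate transpose; $\mathbf{I}_n$ is the $n\times n$ identity matrix; $\delta_{ij}$ is the Kronecker delta. Tensorized circuit: a tensorized circuit $c$ over $\mathbf{X}$ is a parameterized (finite, acyclic) computational graph encoding a function $c(\mathbf{X})$ and comprising three kinds of layers: input, product and sum. A layer $\ell$ is a vector-valued function of a set of variables $\mathrm{sc}(\ell)\subseteq\mathbf{X}$, called its scope. Every non-input layer receives the outputs of other layers as inputs, and its scope is the union of the scopes of its inputs. - Each input layer has scope a single variable $X\in\mathbf{X}$ and computes a vector of $K$ functions $f_1,\dots,f_K:\mathrm{dom}(X)\to\mathbb{C}$. - Each product layer computes either the element-wise (Hadamard) product $\odot_{i=1}^N\ell_i(\mathrm{sc}(\ell_i))$ or the Kronecker product $\otimes_{i=1}^N\ell_i(\mathrm{sc}(\ell_i))$ of the output vectors of its $N$ inputs $\ell_1,\dots,\ell_N$. - Each sum layer has exactly one input $\ell_1$, is parameterized by a matrix $\mathbf{W}\in\mathbb{C}^{K_1\times K_2}$, and computes $\mathbf{W}\,\ell_1(\mathrm{sc}(\ell_1))$. The circuit has a single output layer, with scope $\mathbf{X}$ and a one-dimensional (scalar) output; this output is $c(\mathbf{x})\in\mathbb{C}$.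 Layer size and time: the size of a layer is the total number of scalar inputs to the scalar functions it encodes, which is also its computational cost: a Hadamard layer with $N$ inputs of width $K$ has size $NK$; a Kronecker layer with $N$ inputs of width $K$ has size $NK^N$; a sum layer with parameter matrix in $\mathbb{C}^{K_1\times K_2}$ has size $K_1K_2$. An input layer computing $K$ functions is taken to have size $K$ and to be evaluated at a point at cost $\mathcal{O}(K)$. Time counts arithmetic operations on complex numbers. Decomposable: for every product layer, distinct inputs have disjoint scopes. Structured-decomposable: decomposable and, moreover, each product layer factorizes its scope into the scopes of its inputs in such a way that the collection of all these factorizations (over all product layers) forms a tree of subsets of $\mathbf{X}$. Orthonormal circuit: a tensorized circuit is orthonormal if (1) each input layer, over a variable $X$, encodes a vector $[f_1(X),\dots,f_K(X)]^\top$ of orthonormal functions, i.e., $\int_{\mathrm{dom}(X)}f_i(x)f_j(x)^*\,\mathrm{d}x=\delta_{ij}$ for all $i,j\in[K]$; and (2) each sum layer is parameterized by a (semi-)unitary matrix $\mathbf{W}\in\mathbb{C}^{K_1\times K_2}$ with $K_1\le K_2$, i.e., $\mathbf{W}\mathbf{W}^\dagger=\mathbf{I}_{K_1}$. *)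

theory Defs
  imports "HOL-Analysis.Analysis" "Jordan_Normal_Form.Schur_Decomposition"
begin

text \<open>
  The variables are \<open>1, \<dots>, d\<close>. A value is \<open>Inl r\<close> for a continuous and \<open>Inr v\<close> for a discrete
  variable. An assignment is a function on variables, of which only the values at the variables
  under consideration matter.
\<close>

type_synonym 'v val = "real + 'v"

datatype 'v domain = Continuous "real set" | Discrete "'v set"

fun dom_set :: "'v domain \<Rightarrow> 'v val set" where
  "dom_set (Continuous A) = Inl ` A"
| "dom_set (Discrete A) = Inr ` A"

fun valid_domain :: "'v domain \<Rightarrow> bool" where
  "valid_domain (Continuous A) \<longleftrightarrow> A \<in> sets lebesgue"
| "valid_domain (Discrete A) \<longleftrightarrow> countable A"

fun dom_measure :: "'v domain \<Rightarrow> 'v val measure" where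
  "dom_measure (Continuous A) = embed_measure (lebesgue_on A) Inl"
| "dom_measure (Discrete A) = embed_measure (count_space A) Inr"


text \<open>
  A circuit is a finite acyclic graph, stored as a list of layers in a topological order: layers
  are identified with their positions in the list, and the inputs of a layer are given by their
  positions, which must be smaller than its own. The list describes only the graph; the numerical
  parameters (weight matrices and input functions) are kept apart in the record below, because an
  algorithm may choose its sequence of operations by the graph but not by the parameters.

  \<open>InputLayer i K\<close> computes \<open>K\<close> functions of the variable \<open>i\<close>, and \<open>SumLayer K m\<close> multiplies the
  output of layer \<open>m\<close> by a matrix with \<open>K\<close> rows.
\<close>

datatype layer =
    InputLayer nat nat
  | HadamardLayer "nat list"
  | KroneckerLayer "nat list"
  | SumLayer nat nat

record 'v circuit =
  layers :: "layer list"
  weight :: "nat \<Rightarrow> complex mat"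
  input_fun :: "nat \<Rightarrow> nat \<Rightarrow> 'v val \<Rightarrow> complex"

fun inputs_of :: "layer \<Rightarrow> nat list" where
  "inputs_of (InputLayer i K) = []"
| "inputs_of (HadamardLayer ms) = ms"
| "inputs_of (KroneckerLayer ms) = ms"
| "inputs_of (SumLayer K m) = [m]"

fun is_product :: "layer \<Rightarrow> bool" where
  "is_product (HadamardLayer ms) = True"
| "is_product (KroneckerLayer ms) = True"
| "is_product _ = False"

text \<open>The filter only serves termination; it removes nothing from a valid circuit.\<close>

definition preds :: "layer list \<Rightarrow> nat \<Rightarrow> nat list" where
  "preds L l = filter (\<lambda>m. m < l) (inputs_of (L ! l))"

lemma preds_less [termination_simp]: "m \<in> set (preds L l) \<Longrightarrow> m < l"
  by (simp add: preds_def)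

fun layer_scope :: "layer list \<Rightarrow> nat \<Rightarrow> nat set" where
  "layer_scope L l = (case L ! l of
      InputLayer i K \<Rightarrow> {i}
    | _ \<Rightarrow> \<Union> (set (map (\<lambda>m. layer_scope L m) (preds L l))))"

fun layer_width :: "layer list \<Rightarrow> nat \<Rightarrow> nat" where
  "layer_width L l = (case L ! l of
      InputLayer i K \<Rightarrow> K
    | HadamardLayer ms \<Rightarrow> hd (map (\<lambda>m. layer_width L m) (preds L l))
    | KroneckerLayer ms \<Rightarrow> prod_list (map (\<lambda>m. layer_width L m) (preds L l))
    | SumLayer K m \<Rightarrow> K)"

declare layer_scope.simps [simp del] layer_width.simps [simp del]

text \<open>
  A Kronecker layer may have inputs of different widths: each of its outputs is a product of
  \<open>length ms\<close> numbers. If all widths are \<open>K\<close> this gives the size \<open>N * K ^ N\<close>.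
\<close>

definition layer_size :: "layer list \<Rightarrow> nat \<Rightarrow> nat" where
  "layer_size L l = (case L ! l of
      InputLayer i K \<Rightarrow> K
    | HadamardLayer ms \<Rightarrow> length ms * layer_width L l
    | KroneckerLayer ms \<Rightarrow> length ms * layer_width L l
    | SumLayer K m \<Rightarrow> K * layer_width L m)"

definition max_layer_size :: "layer list \<Rightarrow> nat" where
  "max_layer_size L = Max (layer_size L ` {..<length L})"

fun valid_layer :: "nat \<Rightarrow> layer list \<Rightarrow> layer \<Rightarrow> bool" where
  "valid_layer d L (InputLayer i K) \<longleftrightarrow> i \<in> {1..d} \<and> 0 < K"
| "valid_layer d L (HadamardLayer ms) \<longleftrightarrow>
     ms \<noteq> [] \<and> (\<forall>m\<in>set ms. \<forall>m'\<in>set ms. layer_width L m = layer_width L m')"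
| "valid_layer d L (KroneckerLayer ms) \<longleftrightarrow> ms \<noteq> []"
| "valid_layer d L (SumLayer K m) \<longleftrightarrow> 0 < K"

definition valid_layers :: "nat \<Rightarrow> layer list \<Rightarrow> bool" where
  "valid_layers d L \<longleftrightarrow>
     L \<noteq> [] \<and>
     (\<forall>l<length L. valid_layer d L (L ! l) \<and> (\<forall>m\<in>set (inputs_of (L ! l)). m < l)) \<and>
     (\<forall>m<length L - 1. \<exists>l<length L. m \<in> set (inputs_of (L ! l))) \<and>
     layer_scope L (length L - 1) = {1..d} \<and>
     layer_width L (length L - 1) = 1"

definition valid_circuit :: "nat \<Rightarrow> 'v circuit \<Rightarrow> bool" where
  "valid_circuit d c \<longleftrightarrow>
     valid_layers d (layers c) \<and>
     (\<forall>l<length (layers c). \<forall>K m. layers c ! l = SumLayer K m \<longrightarrow>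
        weight c l \<in> carrier_mat K (layer_width (layers c) m))"


definition hadamard :: "complex vec list \<Rightarrow> complex vec" where
  "hadamard vs = vec (dim_vec (hd vs)) (\<lambda>k. \<Prod>v\<leftarrow>vs. v $ k)"

definition kron :: "complex vec \<Rightarrow> complex vec \<Rightarrow> complex vec" where
  "kron u v = vec (dim_vec u * dim_vec v) (\<lambda>k. u $ (k div dim_vec v) * v $ (k mod dim_vec v))"

definition kronecker :: "complex vec list \<Rightarrow> complex vec" where
  "kronecker vs = foldr kron vs (vec 1 (\<lambda>_. 1))"

fun layer_out :: "'v circuit \<Rightarrow> (nat \<Rightarrow> 'v val) \<Rightarrow> nat \<Rightarrow> complex vec" where
  "layer_out c x l = (case layers c ! l of
      InputLayer i K \<Rightarrow> vec K (\<lambda>k. input_fun c l k (x i))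
    | HadamardLayer ms \<Rightarrow> hadamard (map (\<lambda>m. layer_out c x m) (preds (layers c) l))
    | KroneckerLayer ms \<Rightarrow> kronecker (map (\<lambda>m. layer_out c x m) (preds (layers c) l))
    | SumLayer K m \<Rightarrow> weight c l *\<^sub>v hd (map (\<lambda>m. layer_out c x m) (preds (layers c) l)))"

declare layer_out.simps [simp del]

definition circuit_out :: "'v circuit \<Rightarrow> (nat \<Rightarrow> 'v val) \<Rightarrow> complex" where
  "circuit_out c x = layer_out c x (length (layers c) - 1) $ 0"


definition decomposable :: "layer list \<Rightarrow> bool" where
  "decomposable L \<longleftrightarrow>
     (\<forall>l<length L. is_product (L ! l) \<longrightarrow>
        (let ms = inputs_of (L ! l) in
          \<forall>i<length ms. \<forall>j<length ms. i \<noteq> j \<longrightarrow>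
            layer_scope L (ms ! i) \<inter> layer_scope L (ms ! j) = {}))"

definition rooted_tree :: "'a set \<Rightarrow> 'a \<Rightarrow> ('a \<times> 'a) set \<Rightarrow> bool" where
  "rooted_tree V r E \<longleftrightarrow>
     r \<in> V \<and> E \<subseteq> V \<times> V \<and>
     (\<forall>v\<in>V. (r, v) \<in> E\<^sup>*) \<and>
     (\<forall>u. (u, r) \<notin> E) \<and>
     (\<forall>v\<in>V - {r}. \<exists>!u. (u, v) \<in> E)"

text \<open>
  Parent-child pairs given by the factorizations. A product with a single input only factorizes
  its scope trivially and contributes no pair. In a valid decomposable circuit every scope is
  eventually split into singletons, so unique parents force any two nontrivial factorizations of
  the same scope to coincide.
\<close>

definition scope_edges :: "layer list \<Rightarrow> (nat set \<times> nat set) set" where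
  "scope_edges L = {(layer_scope L l, layer_scope L m) | l m.
     l < length L \<and> is_product (L ! l) \<and> m \<in> set (inputs_of (L ! l)) \<and>
     layer_scope L m \<noteq> layer_scope L l}"

definition structured_decomposable :: "nat \<Rightarrow> layer list \<Rightarrow> bool" where
  "structured_decomposable d L \<longleftrightarrow>
     decomposable L \<and> rooted_tree (layer_scope L ` {..<length L}) {1..d} (scope_edges L)"

text \<open>
  That the integrals of the products exist is part of orthonormality;
  \<open>has_bochner_integral\<close> says this, whereas an equation with \<open>integral\<^sup>L\<close> would
  give non-integrable products the value 0.
\<close>

definition orthonormal_circuit :: "(nat \<Rightarrow> 'v domain) \<Rightarrow> 'v circuit \<Rightarrow> bool" where
  "orthonormal_circuit D c \<longleftrightarrow>
     (\<forall>l<length (layers c).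
        (\<forall>i K. layers c ! l = InputLayer i K \<longrightarrow>
           (\<forall>a<K. \<forall>b<K. has_bochner_integral (dom_measure (D i))
              (\<lambda>t. input_fun c l a t * cnj (input_fun c l b t)) (if a = b then 1 else 0))) \<and>
        (\<forall>K m. layers c ! l = SumLayer K m \<longrightarrow>
           K \<le> layer_width (layers c) m \<and>
           weight c l * mat_adjoint (weight c l) = 1\<^sub>m K))"


definition layers_in :: "layer list \<Rightarrow> nat set \<Rightarrow> nat set" where
  "layers_in L Y = {l. l < length L \<and> layer_scope L l \<subseteq> Y}"

definition layers_across :: "layer list \<Rightarrow> nat set \<Rightarrow> nat set \<Rightarrow> nat set" where
  "layers_across L Y Z =
     {l. l < length L \<and> layer_scope L l \<inter> Y \<noteq> {} \<and> layer_scope L l \<inter> Z \<noteq> {}}"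

text \<open>\<open>merge Y Z (y, z)\<close> takes the values of \<open>y\<close> on \<open>Y\<close> and those of \<open>z\<close> on \<open>Z\<close>.\<close>

definition squared_modulus :: "'v circuit \<Rightarrow> nat set \<Rightarrow> nat set \<Rightarrow>
    (nat \<Rightarrow> 'v val) \<Rightarrow> (nat \<Rightarrow> 'v val) \<Rightarrow> real" where
  "squared_modulus c Y Z y z = (cmod (circuit_out c (merge Y Z (y, z))))\<^sup>2"

definition marginal :: "(nat \<Rightarrow> 'v domain) \<Rightarrow> 'v circuit \<Rightarrow> nat set \<Rightarrow> nat set \<Rightarrow>
    (nat \<Rightarrow> 'v val) \<Rightarrow> real" where
  "marginal D c Y Z y =
     (\<integral>z. squared_modulus c Y Z y z \<partial>(\<Pi>\<^sub>M i\<in>Z. dom_measure (D i)))"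


text \<open>
  The model of computation: straight-line programs over complex registers, initially 0. Operands
  are registers, entries \<open>Weight l i j\<close> of the weight matrices, and the constants 0 and 1; no other
  constants are available. \<open>EvalInput r l\<close> stores the \<open>K\<close> outputs of the input layer \<open>l\<close> at the
  given assignment in the registers \<open>r, \<dots>, r + K - 1\<close>, at cost \<open>K\<close>. Every other instruction is one
  arithmetic operation and costs 1. The input functions are accessible by \<open>EvalInput\<close> only.
\<close>

datatype operand = Reg nat | Weight nat nat nat | Zero | One

datatype instr =
    Add nat operand operand
  | Sub nat operand operand
  | Mul nat operand operand
  | Conj nat operand
  | EvalInput nat nat

type_synonym program = "instr list \<times> operand"

fun operand_val :: "'v circuit \<Rightarrow> (nat \<Rightarrow> complex) \<Rightarrow> operand \<Rightarrow> complex" where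
  "operand_val c s (Reg r) = s r"
| "operand_val c s (Weight l i j) = weight c l $$ (i, j)"
| "operand_val c s Zero = 0"
| "operand_val c s One = 1"

fun exec :: "'v circuit \<Rightarrow> (nat \<Rightarrow> 'v val) \<Rightarrow> instr \<Rightarrow> (nat \<Rightarrow> complex) \<Rightarrow> (nat \<Rightarrow> complex)" where
  "exec c y (Add r a b) s = s(r := operand_val c s a + operand_val c s b)"
| "exec c y (Sub r a b) s = s(r := operand_val c s a - operand_val c s b)"
| "exec c y (Mul r a b) s = s(r := operand_val c s a * operand_val c s b)"
| "exec c y (Conj r a) s = s(r := cnj (operand_val c s a))"
| "exec c y (EvalInput r l) s = (case layers c ! l of
      InputLayer i K \<Rightarrow>
        (\<lambda>q. if r \<le> q \<and> q < r + K then input_fun c l (q - r) (y i) else s q)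
    | _ \<Rightarrow> s)"

definition run :: "program \<Rightarrow> 'v circuit \<Rightarrow> (nat \<Rightarrow> 'v val) \<Rightarrow> complex" where
  "run P c y = operand_val c (fold (exec c y) (fst P) (\<lambda>_. 0)) (snd P)"

fun instr_cost :: "layer list \<Rightarrow> instr \<Rightarrow> nat" where
  "instr_cost L (EvalInput r l) = (case L ! l of InputLayer i K \<Rightarrow> K | _ \<Rightarrow> 0)"
| "instr_cost L _ = 1"

definition time :: "layer list \<Rightarrow> program \<Rightarrow> nat" where
  "time L P = (\<Sum>I\<leftarrow>fst P. instr_cost L I)"

end

theory Submission
  imports Defs
begin

text \<open>
  Let \<open>G\<close> be the Gram matrix of a layer \<open>l\<close>, with entries
  \<open>G (a, b) = \<integral> l\<^sub>a (y, z) * cnj (l\<^sub>b (y, z)) dz\<close> over the variables of \<open>Z\<close> in its scope. By Fubini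
  and decomposability the Gram matrix of a product layer is the Hadamard or Kronecker product of
  those of its inputs, and that of a sum layer is \<open>W G W\<^sup>\<dagger>\<close>. Hence orthonormality makes \<open>G\<close> the
  identity if the scope lies in \<open>Z\<close>, so these layers cost nothing; if the scope lies in \<open>Y\<close>, then
  \<open>G\<close> is determined by the output vector, computed at a cost linear in the layer size. For the
  remaining layers even the naive double sum for \<open>W G W\<^sup>\<dagger>\<close> takes \<open>O(K\<^sub>1\<^sup>2 K\<^sub>2\<^sup>2)\<close> operations, the square
  of the layer size. The marginal is the only entry of the Gram matrix of the output layer.
\<close>

unbundle no vec_syntax

section \<open>Integrals over products of disjoint families\<close>

text \<open>Completing a measure keeps the space and the measure of the old sets, so a countable
  cover by sets of finite measure remains one.\<close>

lemma sigma_finite_completion: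
  assumes "sigma_finite_measure M"
  shows "sigma_finite_measure (completion M)"
proof -
  interpret sigma_finite_measure M by fact
  obtain A where "countable A" "A \<subseteq> sets M" "\<Union>A = space M" "\<forall>a\<in>A. emeasure M a \<noteq> \<infinity>"
    using sigma_finite_countable by blast
  then show ?thesis
    by (intro sigma_finite_measure.intro exI[of _ A]) (auto simp: subset_iff)
qed

text \<open>Fubini needs this. Lebesgue measure is a completion of \<open>lborel\<close>,
  restricting it to a measurable set is harmless, and so is embedding along \<open>Inl\<close> or
  \<open>Inr\<close>; a discrete domain is countable.\<close>

lemma sigma_finite_dom_measure:
  assumes "valid_domain D"
  shows "sigma_finite_measure (dom_measure D)"
proof (cases D)
  case (Continuous A)
  have "sigma_finite_measure (lebesgue_on A)"
    using assms Continuous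
    by (intro sigma_finite_measure_restrict_space sigma_finite_completion)
       (auto intro: sigma_finite_lborel)
  then show ?thesis
    using Continuous by (auto intro: sigma_finite_embed_measure)
next
  case (Discrete A)
  then show ?thesis
    using assms
    by (auto intro: sigma_finite_embed_measure sigma_finite_measure_count_space_countable)
qed

context product_sigma_finite
begin

text \<open>Evaluation at \<open>i\<close> pushes the product over the single index forward to
  \<open>M i\<close>. Orthonormality of an input layer enters through this.\<close>

lemma has_bochner_integral_PiM_singleton:
  fixes f :: "'a \<Rightarrow> 'b::{banach, second_countable_topology}"
  assumes "has_bochner_integral (M i) f a"
  shows "has_bochner_integral (Pi\<^sub>M {i} M) (\<lambda>z. f (z i)) a"
proof -
  have f: "f \<in> borel_measurable (M i)" "integrable (M i) f" "integral\<^sup>L (M i) f = a"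
    using assms by (auto simp: has_bochner_integral_iff)
  have "integrable (distr (Pi\<^sub>M {i} M) (M i) (\<lambda>z. z i)) f"
    using f by (simp add: distr_singleton)
  then show ?thesis
    using f product_integral_singleton[of f i]
    by (auto simp: has_bochner_integral_iff integrable_distr_eq)
qed

text \<open>The empty product is the counting measure on the single point
  \<open>\<lambda>_. undefined\<close>. It covers layers without integrated variables and starts the
  induction over finite products.\<close>

lemma has_bochner_integral_PiM_empty:
  fixes f :: "('i \<Rightarrow> 'a) \<Rightarrow> 'b::{banach, second_countable_topology}"
  shows "has_bochner_integral (Pi\<^sub>M {} M) f (f (\<lambda>_. undefined))"
  unfolding PiM_empty has_bochner_integral_iff
  using lebesgue_integral_count_space_finite[of "{\<lambda>_. undefined}" f]
  by (auto intro: integrable_count_space)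

text \<open>Fubini. Both factors are defined on all assignments; the two congruence hypotheses say
  that they depend only on \<open>I\<close> and on \<open>J\<close>, so that they make sense over
  the union as well.\<close>

lemma has_bochner_integral_PiM_mult:
  fixes f g :: "('i \<Rightarrow> 'a) \<Rightarrow> 'b::{real_normed_field, banach, second_countable_topology}"
  assumes disj: "I \<inter> J = {}" and fin: "finite I" "finite J"
    and f: "has_bochner_integral (Pi\<^sub>M I M) f a"
    and g: "has_bochner_integral (Pi\<^sub>M J M) g b"
    and f_cong: "\<And>z z'. (\<And>i. i \<in> I \<Longrightarrow> z i = z' i) \<Longrightarrow> f z = f z'"
    and g_cong: "\<And>z z'. (\<And>i. i \<in> J \<Longrightarrow> z i = z' i) \<Longrightarrow> g z = g z'"
  shows "has_bochner_integral (Pi\<^sub>M (I \<union> J) M) (\<lambda>z. f z * g z) (a * b)"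
proof -
  interpret I: finite_product_sigma_finite M I by standard fact
  interpret J: finite_product_sigma_finite M J by standard fact
  interpret P: pair_sigma_finite "Pi\<^sub>M I M" "Pi\<^sub>M J M" ..
  have int: "integrable (Pi\<^sub>M I M) f" "integrable (Pi\<^sub>M J M) g"
    and val: "integral\<^sup>L (Pi\<^sub>M I M) f = a" "integral\<^sup>L (Pi\<^sub>M J M) g = b"
    using f g by (auto simp: has_bochner_integral_iff)
  have meas[measurable]: "f \<in> borel_measurable (Pi\<^sub>M I M)" "g \<in> borel_measurable (Pi\<^sub>M J M)"
    using int by auto
  \<comment> \<open>Factoring through the restriction, a measurable map, transfers measurability to
    the larger product.\<close>
  have restr: "f z = f (restrict z I)" "g z = g (restrict z J)" for z
    by (auto intro: f_cong g_cong)
  have mf: "f \<in> borel_measurable (Pi\<^sub>M (I \<union> J) M)"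
    using measurable_compose[OF measurable_restrict_subset meas(1), of "I \<union> J"]
    by (simp flip: restr(1))
  have mg: "g \<in> borel_measurable (Pi\<^sub>M (I \<union> J) M)"
    using measurable_compose[OF measurable_restrict_subset meas(2), of "I \<union> J"]
    by (simp flip: restr(2))
  have merge_eq: "f (merge I J p) * g (merge I J p) = f (fst p) * g (snd p)" for p
  proof -
    have "f (merge I J p) = f (fst p)" "g (merge I J p) = g (snd p)"
      using disj by (auto intro!: f_cong g_cong simp: merge_def split: prod.split)
    then show ?thesis by simp
  qed
  have mp: "(\<lambda>p. f (fst p) * g (snd p)) \<in> borel_measurable (Pi\<^sub>M I M \<Otimes>\<^sub>M Pi\<^sub>M J M)"
    by measurable
  have ip: "integrable (Pi\<^sub>M I M \<Otimes>\<^sub>M Pi\<^sub>M J M) (\<lambda>p. f (fst p) * g (snd p))"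
    using mp by (rule P.Fubini_integrable) (use int in \<open>auto simp: norm_mult\<close>)
  have "integral\<^sup>L (Pi\<^sub>M I M \<Otimes>\<^sub>M Pi\<^sub>M J M) (\<lambda>p. f (fst p) * g (snd p)) = a * b"
    using P.integral_fst'[OF ip] val by simp
  \<comment> \<open>The product over \<open>I \<union> J\<close> is the image of the pair measure
    under \<open>merge\<close>, so the integral can be moved there.\<close>
  then have "has_bochner_integral (Pi\<^sub>M I M \<Otimes>\<^sub>M Pi\<^sub>M J M)
      (\<lambda>p. f (merge I J p) * g (merge I J p)) (a * b)"
    using ip by (simp add: merge_eq has_bochner_integral_iff)
  then have "has_bochner_integral
      (distr (Pi\<^sub>M I M \<Otimes>\<^sub>M Pi\<^sub>M J M) (Pi\<^sub>M (I \<union> J) M) (merge I J)) (\<lambda>z. f z * g z) (a * b)"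
    by (intro has_bochner_integral_distr) (use mf mg in auto)
  then show ?thesis
    by (simp add: distr_merge[OF disj fin])
qed

lemma has_bochner_integral_PiM_prod:
  fixes f :: "'j \<Rightarrow> ('i \<Rightarrow> 'a) \<Rightarrow> 'b::{real_normed_field, banach, second_countable_topology}"
  assumes "finite J" "disjoint_family_on I J"
    and "\<And>j. j \<in> J \<Longrightarrow> finite (I j)"
    and "\<And>j. j \<in> J \<Longrightarrow> has_bochner_integral (Pi\<^sub>M (I j) M) (f j) (a j)"
    and "\<And>j z z'. j \<in> J \<Longrightarrow> (\<And>i. i \<in> I j \<Longrightarrow> z i = z' i) \<Longrightarrow> f j z = f j z'"
  shows "has_bochner_integral (Pi\<^sub>M (\<Union>j\<in>J. I j) M) (\<lambda>z. \<Prod>j\<in>J. f j z) (\<Prod>j\<in>J. a j)"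
  using assms
proof (induction J rule: finite_induct)
  case empty
  show ?case
    using has_bochner_integral_PiM_empty[of "\<lambda>_. 1"] by simp
next
  case (insert k J)
  have "has_bochner_integral (Pi\<^sub>M (I k \<union> (\<Union>j\<in>J. I j)) M)
      (\<lambda>z. f k z * (\<Prod>j\<in>J. f j z)) (a k * (\<Prod>j\<in>J. a j))"
  proof (rule has_bochner_integral_PiM_mult)
    show "I k \<inter> (\<Union>j\<in>J. I j) = {}"
      using insert.hyps insert.prems(1) by (fastforce simp: disjoint_family_on_def)
    show "finite (I k)" "finite (\<Union>j\<in>J. I j)"
      using insert.hyps insert.prems(2) by auto
    show "has_bochner_integral (Pi\<^sub>M (I k) M) (f k) (a k)"
      using insert.prems(3) by simp
    show "has_bochner_integral (Pi\<^sub>M (\<Union>j\<in>J. I j) M) (\<lambda>z. \<Prod>j\<in>J. f j z) (\<Prod>j\<in>J. a j)"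
    proof (rule insert.IH)
      show "disjoint_family_on I J"
        using insert.prems(1) by (simp add: disjoint_family_on_def)
    qed (rule insert.prems; simp)+
    show "f k z = f k z'" if "\<And>i. i \<in> I k \<Longrightarrow> z i = z' i" for z z'
      by (rule insert.prems(4)) (simp_all add: that)
    show "(\<Prod>j\<in>J. f j z) = (\<Prod>j\<in>J. f j z')"
      if "\<And>i. i \<in> (\<Union>j\<in>J. I j) \<Longrightarrow> z i = z' i" for z z'
      by (intro prod.cong refl insert.prems(4)) (auto intro: that)
  qed
  then show ?case
    using insert.hyps by simp
qed

end

section \<open>Compiling expressions to straight-line programs\<close>

text \<open>Symbolic names of registers: entries of output vectors, entries of Gram matrices, cells
  of an evaluation stack, and the final result. Countability gives an injection into the registers,
  so no layout has to be planned.\<close>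

datatype slot = Vec nat nat | Gram nat nat nat | Temp nat | Out

instance slot :: countable
  by countable_datatype

text \<open>The registers below \<open>w\<close> are left free as a contiguous target for \<open>EvalInput\<close>.\<close>

definition reg :: "nat \<Rightarrow> slot \<Rightarrow> nat" where
  "reg w \<sigma> = w + to_nat \<sigma>"

lemma reg_eq_iff [simp]: "reg w \<sigma> = reg w \<tau> \<longleftrightarrow> \<sigma> = \<tau>"
  by (simp add: reg_def)

lemma reg_image_iff [simp]: "reg w \<sigma> \<in> reg w ` A \<longleftrightarrow> \<sigma> \<in> A"
  by auto

lemma reg_ge: "w \<le> reg w \<sigma>"
  by (simp add: reg_def)

datatype expr = Op operand | Plus expr expr | Times expr expr | Cnj expr

abbreviation slot_expr :: "nat \<Rightarrow> slot \<Rightarrow> expr" where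
  "slot_expr w \<sigma> \<equiv> Op (Reg (reg w \<sigma>))"

fun expr_val :: "'v circuit \<Rightarrow> (nat \<Rightarrow> complex) \<Rightarrow> expr \<Rightarrow> complex" where
  "expr_val c s (Op a) = operand_val c s a"
| "expr_val c s (Plus e f) = expr_val c s e + expr_val c s f"
| "expr_val c s (Times e f) = expr_val c s e * expr_val c s f"
| "expr_val c s (Cnj e) = cnj (expr_val c s e)"

fun operand_regs :: "operand \<Rightarrow> nat set" where
  "operand_regs (Reg r) = {r}"
| "operand_regs _ = {}"

fun expr_regs :: "expr \<Rightarrow> nat set" where
  "expr_regs (Op a) = operand_regs a"
| "expr_regs (Plus e f) = expr_regs e \<union> expr_regs f"
| "expr_regs (Times e f) = expr_regs e \<union> expr_regs f"
| "expr_regs (Cnj e) = expr_regs e"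

text \<open>An operand costs 1 because there is no copy instruction: it is moved to the stack by
  adding \<open>Zero\<close>.\<close>

fun expr_cost :: "expr \<Rightarrow> nat" where
  "expr_cost (Op a) = 1"
| "expr_cost (Plus e f) = expr_cost e + expr_cost f + 1"
| "expr_cost (Times e f) = expr_cost e + expr_cost f + 1"
| "expr_cost (Cnj e) = expr_cost e + 1"

text \<open>Stack evaluation: the value ends in \<open>Temp t\<close> and only cells from
  \<open>t\<close> on are written, so the first operand survives the evaluation of the second, which
  starts at \<open>Suc t\<close>.\<close>

fun compile :: "nat \<Rightarrow> nat \<Rightarrow> expr \<Rightarrow> instr list" where
  "compile w t (Op a) = [Add (reg w (Temp t)) a Zero]"
| "compile w t (Plus e f) = compile w t e @ compile w (Suc t) f @
     [Add (reg w (Temp t)) (Reg (reg w (Temp t))) (Reg (reg w (Temp (Suc t))))]"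
| "compile w t (Times e f) = compile w t e @ compile w (Suc t) f @
     [Mul (reg w (Temp t)) (Reg (reg w (Temp t))) (Reg (reg w (Temp (Suc t))))]"
| "compile w t (Cnj e) = compile w t e @ [Conj (reg w (Temp t)) (Reg (reg w (Temp t)))]"

lemma expr_val_cong:
  assumes "\<And>r. r \<in> expr_regs e \<Longrightarrow> s r = s' r"
  shows "expr_val c s e = expr_val c s' e"
  using assms
proof (induction e)
  case (Op a)
  then show ?case by (cases a) auto
qed auto

text \<open>Value and frame property are proved together, since the value of a binary expression
  depends on what its two parts leave untouched.\<close>

lemma fold_compile:
  assumes "expr_regs e \<inter> reg w ` range Temp = {}"
  shows "fold (exec c y) (compile w t e) s (reg w (Temp t)) = expr_val c s e"
    and "r \<notin> reg w ` Temp ` {t..} \<Longrightarrow> fold (exec c y) (compile w t e) s r = s r"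
  using assms
proof (induction e arbitrary: s t r)
  case (Op a)
  { case 1 then show ?case by simp }
  { case 2 then show ?case by auto }
next
  case (Plus e f)
  have e: "expr_regs e \<inter> reg w ` range Temp = {}" and f: "expr_regs f \<inter> reg w ` range Temp = {}"
    if "expr_regs (Plus e f) \<inter> reg w ` range Temp = {}"
    using that by auto
  { case 1
    \<comment> \<open>Evaluating \<open>e\<close> changes stack cells only, which \<open>f\<close>
      does not read; evaluating \<open>f\<close> in turn spares \<open>Temp t\<close>, which holds
      the value of \<open>e\<close>.\<close>
    have "expr_val c (fold (exec c y) (compile w t e) s) f = expr_val c s f"
      by (intro expr_val_cong Plus.IH(2)[OF _ e[OF 1]]) (use f[OF 1] in auto)
    moreover have "reg w (Temp t) \<notin> reg w ` Temp ` {Suc t..}" by auto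
    ultimately show ?case
      by (simp add: Plus.IH(1)[OF e[OF 1]] Plus.IH(3)[OF f[OF 1]] Plus.IH(4)[OF _ f[OF 1]]) }
  { case 2
    have "r \<notin> reg w ` Temp ` {Suc t..}" "r \<noteq> reg w (Temp t)" using 2(1) by auto
    then show ?case
      by (simp add: Plus.IH(2)[OF 2(1) e[OF 2(2)]] Plus.IH(4)[OF _ f[OF 2(2)]]) }
next
  case (Times e f)
  have e: "expr_regs e \<inter> reg w ` range Temp = {}" and f: "expr_regs f \<inter> reg w ` range Temp = {}"
    if "expr_regs (Times e f) \<inter> reg w ` range Temp = {}"
    using that by auto
  { case 1
    have "expr_val c (fold (exec c y) (compile w t e) s) f = expr_val c s f"
      by (intro expr_val_cong Times.IH(2)[OF _ e[OF 1]]) (use f[OF 1] in auto)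
    moreover have "reg w (Temp t) \<notin> reg w ` Temp ` {Suc t..}" by auto
    ultimately show ?case
      by (simp add: Times.IH(1)[OF e[OF 1]] Times.IH(3)[OF f[OF 1]] Times.IH(4)[OF _ f[OF 1]]) }
  { case 2
    have "r \<notin> reg w ` Temp ` {Suc t..}" "r \<noteq> reg w (Temp t)" using 2(1) by auto
    then show ?case
      by (simp add: Times.IH(2)[OF 2(1) e[OF 2(2)]] Times.IH(4)[OF _ f[OF 2(2)]]) }
next
  case (Cnj e)
  { case 1 then show ?case using Cnj.IH(1) by simp }
  { case 2
    then have "r \<noteq> reg w (Temp t)" by auto
    with 2 show ?case using Cnj.IH(2) by simp }
qed

lemma time_compile: "(\<Sum>I\<leftarrow>compile w t e. instr_cost L I) = expr_cost e"
  by (induction e arbitrary: t) auto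

definition assign :: "nat \<Rightarrow> (slot \<times> expr) list \<Rightarrow> instr list" where
  "assign w xs = concat (map (\<lambda>(\<sigma>, e).
     compile w 0 e @ [Add (reg w \<sigma>) (Reg (reg w (Temp 0))) Zero]) xs)"

lemma time_assign: "(\<Sum>I\<leftarrow>assign w xs. instr_cost L I) = (\<Sum>(\<sigma>, e)\<leftarrow>xs. expr_cost e + 1)"
  by (induction xs) (auto simp: assign_def time_compile)

text \<open>No expression reads a target or a stack cell, and the targets are distinct. The sequence
  therefore acts like one simultaneous assignment evaluated in the initial state.\<close>

lemma fold_assign:
  assumes "distinct (map fst xs)"
    and "fst ` set xs \<inter> range Temp = {}"
    and "\<forall>x\<in>set xs. expr_regs (snd x) \<inter> reg w ` (range Temp \<union> fst ` set xs) = {}"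
  shows "(\<sigma>, e) \<in> set xs \<Longrightarrow> fold (exec c y) (assign w xs) s (reg w \<sigma>) = expr_val c s e"
    and "r \<notin> reg w ` (range Temp \<union> fst ` set xs) \<Longrightarrow> fold (exec c y) (assign w xs) s r = s r"
  using assms
proof (induction xs arbitrary: s \<sigma> e r)
  case Nil
  { case 1 then show ?case by simp }
  { case 2 then show ?case by (simp add: assign_def) }
next
  case (Cons x xs)
  obtain \<tau> f where x: "x = (\<tau>, f)" by (cases x)
  define upd where "upd = fold (exec c y) (compile w 0 f @ [Add (reg w \<tau>) (Reg (reg w (Temp 0))) Zero])"
  have step: "fold (exec c y) (assign w (x # xs)) s = fold (exec c y) (assign w xs) (upd s)" for s
    by (simp add: assign_def x upd_def)
  have facts: "distinct (map fst xs)" "fst ` set xs \<inter> range Temp = {}"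
      "\<forall>x\<in>set xs. expr_regs (snd x) \<inter> reg w ` (range Temp \<union> fst ` set xs) = {}"
      "\<tau> \<notin> fst ` set xs" "\<tau> \<notin> range Temp" "expr_regs f \<inter> reg w ` range Temp = {}"
      "\<forall>x\<in>set xs. expr_regs (snd x) \<inter> reg w ` insert \<tau> (range Temp) = {}"
    if d: "distinct (map fst (x # xs))" and t: "fst ` set (x # xs) \<inter> range Temp = {}"
      and r: "\<forall>x'\<in>set (x # xs). expr_regs (snd x') \<inter> reg w ` (range Temp \<union> fst ` set (x # xs)) = {}"
    using d t r x by (simp_all add: image_Un Int_Un_distrib)
  have val: "upd s (reg w \<tau>) = expr_val c s f"
    and other: "q \<notin> reg w ` insert \<tau> (range Temp) \<Longrightarrow> upd s q = s q"
    if "expr_regs f \<inter> reg w ` range Temp = {}" for q s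
    using fold_compile[OF that, where c = c and y = y and t = 0 and s = s] by (auto simp: upd_def)
  { case 1
    note F = facts[OF 1(2,3,4)]
    show ?case
    proof (cases "(\<sigma>, e) \<in> set xs")
      case True
      have "expr_regs e \<inter> reg w ` insert \<tau> (range Temp) = {}"
        using bspec[OF F(7) True] by simp
      then have "expr_val c (upd s) e = expr_val c s e"
        by (intro expr_val_cong other[OF F(6)]) blast
      then show ?thesis
        unfolding step using Cons.IH(1)[OF True F(1-3)] by simp
    next
      case False
      then have [simp]: "\<sigma> = \<tau>" "e = f" using 1(1) x by auto
      \<comment> \<open>By distinctness the remaining assignments do not overwrite the value just
        stored.\<close>
      have "reg w \<tau> \<notin> reg w ` (range Temp \<union> fst ` set xs)" using F(4,5) by auto
      from Cons.IH(2)[OF this F(1-3)] show ?thesis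
        unfolding step using val[OF F(6)] by simp
    qed }
  { case 2
    note F = facts[OF 2(2,3,4)]
    have "r \<notin> reg w ` (range Temp \<union> fst ` set xs)" "r \<notin> reg w ` insert \<tau> (range Temp)"
      using 2(1) x by auto
    then show ?case
      unfolding step using Cons.IH(2)[OF _ F(1-3)] other[OF F(6)] by simp }
qed

definition sum_expr :: "expr list \<Rightarrow> expr" where
  "sum_expr es = foldr Plus es (Op Zero)"

definition prod_expr :: "expr list \<Rightarrow> expr" where
  "prod_expr es = foldr Times es (Op One)"

lemma sum_expr_simps [simp]:
  "expr_val c s (sum_expr es) = (\<Sum>e\<leftarrow>es. expr_val c s e)"
  "expr_regs (sum_expr es) = (\<Union>e\<in>set es. expr_regs e)"
  "expr_cost (sum_expr es) = (\<Sum>e\<leftarrow>es. expr_cost e + 1) + 1"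
  by (induction es) (auto simp: sum_expr_def)

lemma prod_expr_simps [simp]:
  "expr_val c s (prod_expr es) = (\<Prod>e\<leftarrow>es. expr_val c s e)"
  "expr_regs (prod_expr es) = (\<Union>e\<in>set es. expr_regs e)"
  "expr_cost (prod_expr es) = (\<Sum>e\<leftarrow>es. expr_cost e + 1) + 1"
  by (induction es) (auto simp: prod_expr_def)

section \<open>Layers, scopes and widths\<close>

text \<open>Mixed-radix digits, most significant first.\<close>

fun digits :: "nat list \<Rightarrow> nat \<Rightarrow> nat list" where
  "digits [] k = []"
| "digits (w # ws) k = (k div prod_list ws) # digits ws (k mod prod_list ws)"

lemma length_digits [simp]: "length (digits ws k) = length ws"
  by (induction ws arbitrary: k) auto

lemma digits_less:
  assumes "k < prod_list ws" "j < length ws"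
  shows "digits ws k ! j < ws ! j"
  using assms
proof (induction ws arbitrary: k j)
  case (Cons w ws)
  have pos: "0 < prod_list ws"
    using Cons.prems(1) by (metis gr0I mult_0_right not_less0 prod_list.Cons)
  show ?case
  proof (cases j)
    case 0
    then show ?thesis
      using Cons.prems(1) by (simp add: less_mult_imp_div_less)
  next
    case (Suc i)
    then show ?thesis
      using Cons.IH[of "k mod prod_list ws" i] Cons.prems(2) pos by simp
  qed
qed simp

text \<open>Each step of \<open>digits\<close> is a division with remainder, from which the number
  is recovered. Distinct entries of a Kronecker layer thus differ in some factor.\<close>

lemma digits_eq_iff:
  assumes "k < prod_list ws" "k' < prod_list ws"
  shows "digits ws k = digits ws k' \<longleftrightarrow> k = k'"
  using assms
proof (induction ws arbitrary: k k')
  case (Cons w ws)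
  have pos: "0 < prod_list ws"
    using Cons.prems(1) by (metis gr0I mult_0_right not_less0 prod_list.Cons)
  show ?case
  proof
    assume "digits (w # ws) k = digits (w # ws) k'"
    then have "k div prod_list ws = k' div prod_list ws" "k mod prod_list ws = k' mod prod_list ws"
      using Cons.IH[of "k mod prod_list ws" "k' mod prod_list ws"] pos by simp_all
    then show "k = k'"
      by (metis div_mult_mod_eq)
  qed simp
qed simp

lemma dim_kron [simp]: "dim_vec (kron u v) = dim_vec u * dim_vec v"
  by (simp add: kron_def)

lemma kronecker_simps [simp]:
  "kronecker [] = vec 1 (\<lambda>_. 1)" "kronecker (v # vs) = kron v (kronecker vs)"
  by (simp_all add: kronecker_def)

lemma dim_kronecker: "dim_vec (kronecker vs) = prod_list (map dim_vec vs)"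
  by (induction vs) auto

text \<open>\<open>kron\<close> splits an index by the dimension of the remaining product, just as
  \<open>digits\<close> does.\<close>

lemma index_kronecker:
  assumes "k < prod_list (map dim_vec vs)"
  shows "kronecker vs $ k = (\<Prod>j<length vs. vs ! j $ (digits (map dim_vec vs) k ! j))"
  using assms
proof (induction vs arbitrary: k)
  case (Cons v vs)
  have pos: "0 < prod_list (map dim_vec vs)"
    using Cons.prems by (metis gr0I list.simps(9) mult_0_right not_less0 prod_list.Cons)
  let ?p = "prod_list (map dim_vec vs)"
  have "kronecker (v # vs) $ k = v $ (k div ?p) * kronecker vs $ (k mod ?p)"
    using Cons.prems by (simp add: kron_def dim_kronecker)
  also have "kronecker vs $ (k mod ?p) =
      (\<Prod>j<length vs. vs ! j $ (digits (map dim_vec vs) (k mod ?p) ! j))"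
    using Cons.IH pos by simp
  finally show ?case
    by (simp add: prod.lessThan_Suc_shift del: prod.lessThan_Suc)
qed simp

text \<open>
  The positions in the outputs of the inputs whose product is the entry \<open>k\<close> of the output of a
  product layer.
\<close>

definition indices :: "layer list \<Rightarrow> nat \<Rightarrow> nat \<Rightarrow> nat list" where
  "indices L l k = (case L ! l of
      HadamardLayer ms \<Rightarrow> map (\<lambda>_. k) ms
    | KroneckerLayer ms \<Rightarrow> digits (map (layer_width L) ms) k
    | _ \<Rightarrow> [])"

lemma length_indices [simp]:
  "is_product (L ! l) \<Longrightarrow> length (indices L l k) = length (inputs_of (L ! l))"
  by (cases "L ! l") (auto simp: indices_def)

lemma is_product_cases:
  assumes "is_product la"
  obtains (Hadamard) ms where "la = HadamardLayer ms" | (Kronecker) ms where "la = KroneckerLayer ms"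
  using assms by (cases la) auto

text \<open>Facts about the graph alone are kept apart from the parameters, because the program and
  its cost are functions of the graph.\<close>

locale circuit_graph =
  fixes d :: nat and L :: "layer list"
  assumes valid_layers: "valid_layers d L"
begin

lemma layer:
  assumes "l < length L"
  shows "valid_layer d L (L ! l)" "m \<in> set (inputs_of (L ! l)) \<Longrightarrow> m < l"
    "m \<in> set (inputs_of (L ! l)) \<Longrightarrow> m < length L"
proof -
  have *: "valid_layer d L (L ! l) \<and> (\<forall>m\<in>set (inputs_of (L ! l)). m < l)"
    using assms valid_layers unfolding valid_layers_def by blast
  then show "valid_layer d L (L ! l)" by blast
  show "m < l" "m < length L" if "m \<in> set (inputs_of (L ! l))"
    using * that assms by auto
qed

lemma preds_eq: "l < length L \<Longrightarrow> preds L l = inputs_of (L ! l)"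
  using layer(2)[of l] by (simp add: preds_def)

lemma scope_input:
  assumes "L ! l = InputLayer i K"
  shows "layer_scope L l = {i}"
  using assms by (subst layer_scope.simps) simp

lemma scope_inputs:
  assumes "l < length L" "inputs_of (L ! l) \<noteq> []"
  shows "layer_scope L l = (\<Union>m\<in>set (inputs_of (L ! l)). layer_scope L m)"
  using assms by (subst layer_scope.simps) (auto simp: preds_eq split: layer.splits)

lemma scope_mono:
  assumes "l < length L" "m \<in> set (inputs_of (L ! l))"
  shows "layer_scope L m \<subseteq> layer_scope L l"
  using assms scope_inputs[of l] by fastforce

lemma inputs_empty_iff:
  assumes "l < length L"
  shows "inputs_of (L ! l) = [] \<longleftrightarrow> (\<exists>i K. L ! l = InputLayer i K)"
  using layer(1)[OF assms] by (cases "L ! l") auto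

text \<open>Non-empty scopes cannot be contained in \<open>Z\<close> and disjoint from it at once,
  so the three cases of the algorithm exclude each other.\<close>

lemma scope:
  assumes "l < length L"
  shows "layer_scope L l \<noteq> {}" "layer_scope L l \<subseteq> {1..d}"
proof -
  have "layer_scope L l \<noteq> {} \<and> layer_scope L l \<subseteq> {1..d}"
    using assms
  proof (induction l rule: less_induct)
    case (less l)
    show ?case
    proof (cases "inputs_of (L ! l) = []")
      case True
      then obtain i K where "L ! l = InputLayer i K"
        using inputs_empty_iff less.prems by blast
      then show ?thesis
        using layer(1)[OF less.prems] scope_input by auto
    next
      case False
      then obtain m where "m \<in> set (inputs_of (L ! l))"
        by (cases "inputs_of (L ! l)") auto
      then show ?thesis
        using less.IH layer[OF less.prems] by (auto simp: scope_inputs[OF less.prems False])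
    qed
  qed
  then show "layer_scope L l \<noteq> {}" "layer_scope L l \<subseteq> {1..d}" by auto
qed

lemma width_input: "L ! l = InputLayer i K \<Longrightarrow> layer_width L l = K"
  by (subst layer_width.simps) simp

lemma width_sum: "L ! l = SumLayer K m \<Longrightarrow> layer_width L l = K"
  by (subst layer_width.simps) simp

lemma width_hadamard:
  assumes "l < length L" "L ! l = HadamardLayer ms" "m \<in> set ms"
  shows "layer_width L m = layer_width L l"
proof -
  have "layer_width L l = layer_width L (hd ms)"
    using layer(1)[OF assms(1)] assms(2)
    by (subst layer_width.simps) (simp add: assms(2) preds_eq[OF assms(1)] hd_map)
  moreover have "hd ms \<in> set ms"
    using assms(3) by (cases ms) auto
  ultimately show ?thesis
    using layer(1)[OF assms(1)] assms(2,3) by (metis valid_layer.simps(2))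
qed

lemma width_kronecker:
  assumes "l < length L" "L ! l = KroneckerLayer ms"
  shows "layer_width L l = prod_list (map (layer_width L) ms)"
  by (subst layer_width.simps) (simp add: assms preds_eq)

lemma product_inputs_nonempty:
  assumes "l < length L" "is_product (L ! l)"
  shows "inputs_of (L ! l) \<noteq> []"
  using layer(1)[OF assms(1)] assms(2) by (cases "L ! l") auto

text \<open>Positive widths allow constant terms in the operation counts to be absorbed into layer
  sizes.\<close>

lemma width_pos: "l < length L \<Longrightarrow> 0 < layer_width L l"
proof (induction l rule: less_induct)
  case (less l)
  note v = layer[OF less.prems]
  show ?case
  proof (cases "L ! l")
    case (HadamardLayer ms)
    then have "hd ms \<in> set ms" using v(1) by (cases ms) auto
    then show ?thesis
      using less.IH[of "hd ms"] v width_hadamard[OF less.prems HadamardLayer] HadamardLayer by auto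
  next
    case (KroneckerLayer ms)
    have "0 < layer_width L m" if "m \<in> set ms" for m
      using less.IH[of m] v that KroneckerLayer by auto
    then have "0 < prod_list (map (layer_width L) ms)"
      by (induction ms) auto
    then show ?thesis
      using width_kronecker[OF less.prems KroneckerLayer] by simp
  qed (use v(1) width_input width_sum in auto)
qed

lemma indices_less:
  assumes "l < length L" "is_product (L ! l)" "k < layer_width L l" "j < length (inputs_of (L ! l))"
  shows "indices L l k ! j < layer_width L (inputs_of (L ! l) ! j)"
  using assms(2)
proof (cases rule: is_product_cases)
  case (Hadamard ms)
  then show ?thesis
    using assms width_hadamard[OF assms(1) Hadamard, of "ms ! j"] by (simp add: indices_def)
next
  case (Kronecker ms)
  then show ?thesis
    using assms width_kronecker[OF assms(1) Kronecker] digits_less[of k "map (layer_width L) ms" j]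
    by (simp add: indices_def)
qed

text \<open>A Hadamard layer has at least one input, and there the index is the entry itself; for a
  Kronecker layer the digits determine the entry. This makes products of identity Gram matrices the
  identity.\<close>

lemma indices_eq_iff:
  assumes "l < length L" "is_product (L ! l)" "k < layer_width L l" "k' < layer_width L l"
  shows "indices L l k = indices L l k' \<longleftrightarrow> k = k'"
  using assms(2)
proof (cases rule: is_product_cases)
  case (Hadamard ms)
  then show ?thesis
    using product_inputs_nonempty[OF assms(1,2)] by (cases ms) (auto simp: indices_def)
next
  case (Kronecker ms)
  then show ?thesis
    using assms width_kronecker[OF assms(1) Kronecker] digits_eq_iff[of k "map (layer_width L) ms" k']
    by (simp add: indices_def)
qed

end

section \<open>Gram matrices\<close>

locale valid_circuit_graph =
  fixes d :: nat and c :: "'v circuit"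
  assumes valid_circuit: "valid_circuit d c"

sublocale valid_circuit_graph \<subseteq> circuit_graph d "layers c"
  using valid_circuit by unfold_locales (simp add: valid_circuit_def)

context valid_circuit_graph
begin

abbreviation "L \<equiv> layers c"

lemma weight_carrier:
  assumes "l < length L" "L ! l = SumLayer K m"
  shows "weight c l \<in> carrier_mat K (layer_width L m)"
  using assms valid_circuit unfolding valid_circuit_def by blast

lemma layer_out_input:
  assumes "L ! l = InputLayer i K"
  shows "layer_out c x l = vec K (\<lambda>k. input_fun c l k (x i))"
  by (subst layer_out.simps) (simp add: assms)

lemma layer_out_sum:
  assumes "l < length L" "L ! l = SumLayer K m"
  shows "layer_out c x l = weight c l *\<^sub>v layer_out c x m"
  by (subst layer_out.simps) (simp add: assms preds_eq)

lemma dim_layer_out: "l < length L \<Longrightarrow> dim_vec (layer_out c x l) = layer_width L l"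
proof (induction l rule: less_induct)
  case (less l)
  note v = layer[OF less.prems]
  show ?case
  proof (cases "L ! l")
    case (InputLayer i K)
    then show ?thesis by (simp add: layer_out_input width_input)
  next
    case (HadamardLayer ms)
    then have hd: "hd ms \<in> set ms" using v(1) by (cases ms) auto
    then have "dim_vec (layer_out c x (hd ms)) = layer_width L (hd ms)"
      using less.IH v(2,3) HadamardLayer by simp
    moreover have "dim_vec (layer_out c x l) = dim_vec (layer_out c x (hd ms))"
      using v(1) HadamardLayer
      by (subst layer_out.simps) (simp add: preds_eq[OF less.prems] hadamard_def hd_map)
    ultimately show ?thesis
      using width_hadamard[OF less.prems HadamardLayer hd] by simp
  next
    case (KroneckerLayer ms)
    then have "map (\<lambda>m. dim_vec (layer_out c x m)) ms = map (layer_width L) ms"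
      using less.IH v(2,3) by simp
    then show ?thesis
      using KroneckerLayer width_kronecker[OF less.prems KroneckerLayer]
      by (subst layer_out.simps) (simp add: preds_eq[OF less.prems] dim_kronecker comp_def cong: map_cong)
  next
    case (SumLayer K m)
    then show ?thesis
      using weight_carrier[OF less.prems SumLayer]
      by (simp add: layer_out_sum[OF less.prems SumLayer] width_sum)
  qed
qed

text \<open>Through \<open>indices\<close> both kinds of product layer take one form, one factor per
  input, so later arguments need not tell them apart.\<close>

lemma index_layer_out_product:
  assumes "l < length L" "is_product (L ! l)" "k < layer_width L l"
  shows "layer_out c x l $ k =
    (\<Prod>j<length (inputs_of (L ! l)). layer_out c x (inputs_of (L ! l) ! j) $ (indices L l k ! j))"
  using assms(2)
proof (cases rule: is_product_cases)
  case (Hadamard ms)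
  have "dim_vec (layer_out c x (hd ms)) = layer_width L l"
  proof -
    have "hd ms \<in> set ms"
      using Hadamard product_inputs_nonempty[OF assms(1,2)] by simp
    then show ?thesis
      using dim_layer_out layer(3)[OF assms(1)] width_hadamard[OF assms(1) Hadamard] Hadamard
      by simp
  qed
  then have "layer_out c x l $ k = (\<Prod>v\<leftarrow>map (layer_out c x) ms. v $ k)"
    using Hadamard product_inputs_nonempty[OF assms(1,2)] assms(3)
    by (subst layer_out.simps) (simp add: preds_eq[OF assms(1)] hadamard_def hd_map)
  then show ?thesis
    using Hadamard by (simp add: indices_def prod.list_conv_set_nth atLeast0LessThan)
next
  case (Kronecker ms)
  have dims: "map (\<lambda>m. dim_vec (layer_out c x m)) ms = map (layer_width L) ms"
    using Kronecker dim_layer_out layer(3)[OF assms(1)] by simp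
  have "layer_out c x l = kronecker (map (layer_out c x) ms)"
    using Kronecker by (subst layer_out.simps) (simp add: preds_eq[OF assms(1)])
  moreover have "k < prod_list (map dim_vec (map (layer_out c x) ms))"
    using width_kronecker[OF assms(1) Kronecker] assms(3) dims by (simp add: comp_def del: map_eq_conv)
  ultimately show ?thesis
    using Kronecker dims by (simp add: index_kronecker indices_def comp_def cong: map_cong)
qed

lemma index_layer_out_sum:
  assumes "l < length L" "L ! l = SumLayer K m" "k < K"
  shows "layer_out c x l $ k = (\<Sum>j<layer_width L m. weight c l $$ (k, j) * layer_out c x m $ j)"
proof -
  have "m < length L"
    using layer(3)[OF assms(1)] assms(2) by simp
  then have "dim_vec (layer_out c x m) = layer_width L m"
    by (rule dim_layer_out)
  then show ?thesis
    using assms(3) weight_carrier[OF assms(1,2)]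
    by (auto simp: layer_out_sum[OF assms(1,2)] scalar_prod_def atLeast0LessThan intro!: sum.cong)
qed

text \<open>By induction along the inputs, whose scopes lie in that of the layer. It supplies the
  independence hypotheses of Fubini and removes \<open>z\<close> from layers observed by
  \<open>y\<close>.\<close>

lemma layer_out_cong:
  assumes "l < length L" "\<And>i. i \<in> layer_scope L l \<Longrightarrow> x i = x' i"
  shows "layer_out c x l = layer_out c x' l"
  using assms
proof (induction l rule: less_induct)
  case (less l)
  have IH: "layer_out c x m = layer_out c x' m" if m: "m \<in> set (inputs_of (L ! l))" for m
  proof (rule less.IH)
    show "m < l" "m < length L" using layer[OF less.prems(1)] m by auto
    show "x i = x' i" if "i \<in> layer_scope L m" for i
      using that scope_mono[OF less.prems(1) m] less.prems(2) by blast
  qed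
  show ?case
  proof (cases "L ! l")
    case (InputLayer i K)
    then show ?thesis
      using less.prems(2)[of i] by (simp add: layer_out_input scope_input)
  next
    case (SumLayer K m)
    then show ?thesis
      using IH by (simp add: layer_out_sum[OF less.prems(1)])
  next
    case (HadamardLayer ms)
    then have "map (layer_out c x) ms = map (layer_out c x') ms"
      using IH by simp
    then show ?thesis
      using HadamardLayer by (subst (1 2) layer_out.simps) (simp add: preds_eq[OF less.prems(1)] cong: map_cong)
  next
    case (KroneckerLayer ms)
    then have "map (layer_out c x) ms = map (layer_out c x') ms"
      using IH by simp
    then show ?thesis
      using KroneckerLayer by (subst (1 2) layer_out.simps) (simp add: preds_eq[OF less.prems(1)] cong: map_cong)
  qed
qed

end

section \<open>Recursion for the Gram matrices under evidence\<close>

locale circuit_marginal = valid_circuit_graph d c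
  for d and c :: "'v circuit" +
  fixes D :: "nat \<Rightarrow> 'v domain" and Y Z :: "nat set" and y :: "nat \<Rightarrow> 'v val"
  assumes domains: "\<forall>i\<in>{1..d}. valid_domain (D i)"
    and decomp: "decomposable (layers c)"
    and orthonormal: "orthonormal_circuit D c"
    and Z: "Z \<subseteq> {1..d}"
    and Y: "Y = {1..d} - Z"
begin

text \<open>
  Outside the variables the domains are unrestricted, whereas product measures are only available
  for families that are \<open>\<sigma>\<close>-finite everywhere.
\<close>

definition M :: "nat \<Rightarrow> 'v val measure" where
  "M i = (if i \<in> {1..d} then dom_measure (D i) else count_space {})"

sublocale product_sigma_finite M
proof (rule product_sigma_finite.intro)
  show "sigma_finite_measure (M i)" for i
    using domains
    by (cases "i \<in> {1..d}")
       (simp_all add: M_def sigma_finite_dom_measure sigma_finite_measure_count_space_finite)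
qed

definition out :: "nat \<Rightarrow> nat \<Rightarrow> (nat \<Rightarrow> 'v val) \<Rightarrow> complex" where
  "out l k z = layer_out c (merge Y Z (y, z)) l $ k"

definition gram :: "nat \<Rightarrow> nat \<Rightarrow> nat \<Rightarrow> complex" where
  "gram l a b = (\<integral>z. out l a z * cnj (out l b z) \<partial>Pi\<^sub>M (layer_scope L l \<inter> Z) M)"

text \<open>Records integrability together with the value; the integral in \<open>gram\<close> alone
  would default to 0 for a non-integrable product.\<close>

definition has_gram :: "nat \<Rightarrow> nat \<Rightarrow> nat \<Rightarrow> complex \<Rightarrow> bool" where
  "has_gram l a b v \<longleftrightarrow>
    has_bochner_integral (Pi\<^sub>M (layer_scope L l \<inter> Z) M) (\<lambda>z. out l a z * cnj (out l b z)) v"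

lemma has_gramD: "has_gram l a b v \<Longrightarrow> gram l a b = v"
  by (simp add: has_gram_def gram_def has_bochner_integral_integral_eq)

lemma out_cong:
  assumes "l < length L" "\<And>i. i \<in> layer_scope L l \<inter> Z \<Longrightarrow> z i = z' i"
  shows "out l k z = out l k z'"
proof -
  have "layer_out c (merge Y Z (y, z)) l = layer_out c (merge Y Z (y, z')) l"
    by (rule layer_out_cong[OF assms(1)]) (auto simp: merge_def intro!: assms(2))
  then show ?thesis by (simp add: out_def)
qed

lemma out_observed:
  assumes "l < length L" "layer_scope L l \<inter> Z = {}"
  shows "out l k z = layer_out c y l $ k"
proof -
  have "layer_out c (merge Y Z (y, z)) l = layer_out c y l"
    using scope(2)[OF assms(1)] assms(2) Y
    by (intro layer_out_cong[OF assms(1)]) (auto simp: merge_def)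
  then show ?thesis by (simp add: out_def)
qed

text \<open>Nothing is integrated and the integrand is constant, so the Gram matrix is the rank-one
  matrix of the output vector.\<close>

lemma has_gram_observed:
  assumes "l < length L" "layer_scope L l \<inter> Z = {}"
  shows "has_gram l a b (layer_out c y l $ a * cnj (layer_out c y l $ b))"
  unfolding has_gram_def assms(2) out_observed[OF assms]
  using has_bochner_integral_PiM_empty[of "\<lambda>_. layer_out c y l $ a * cnj (layer_out c y l $ b)"]
  by simp

lemma has_gram_input:
  assumes "l < length L" "L ! l = InputLayer i K" "i \<in> Z" "a < K" "b < K"
  shows "has_gram l a b (if a = b then 1 else 0)"
proof -
  have "has_bochner_integral (dom_measure (D i))
      (\<lambda>t. input_fun c l a t * cnj (input_fun c l b t)) (if a = b then 1 else 0)"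
    using orthonormal assms unfolding orthonormal_circuit_def by blast
  then have "has_bochner_integral (M i)
      (\<lambda>t. input_fun c l a t * cnj (input_fun c l b t)) (if a = b then 1 else 0)"
    using assms(3) Z by (auto simp: M_def)
  then have "has_bochner_integral (Pi\<^sub>M {i} M)
      (\<lambda>z. input_fun c l a (z i) * cnj (input_fun c l b (z i))) (if a = b then 1 else 0)"
    by (rule has_bochner_integral_PiM_singleton)
  \<comment> \<open>\<open>merge\<close> gives precedence to \<open>Y\<close>, so it reads
    \<open>z i\<close> because \<open>i\<close> lies outside \<open>Y\<close>.\<close>
  moreover have "out l k z = input_fun c l k (z i)" if "k < K" for k z
  proof -
    have "i \<notin> Y" using assms(3) Y by simp
    then show ?thesis
      using that assms(3) by (simp add: out_def layer_out_input[OF assms(2)] merge_def)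
  qed
  ultimately show ?thesis
    using assms scope_input[OF assms(2)] by (simp add: has_gram_def)
qed

text \<open>An entry times a conjugate entry regroups into one such product per input. By
  decomposability these depend on disjoint sets of variables, so Fubini applies.\<close>

lemma has_gram_product:
  assumes "l < length L" "is_product (L ! l)" "a < layer_width L l" "b < layer_width L l"
    and ms: "ms = inputs_of (L ! l)"
    and inputs: "\<And>j. j < length ms \<Longrightarrow>
      has_gram (ms ! j) (indices L l a ! j) (indices L l b ! j) (v j)"
  shows "has_gram l a b (\<Prod>j<length ms. v j)"
proof -
  have m: "ms ! j < length L" if "j < length ms" for j
    using that layer(3)[OF assms(1)] ms by simp
  have "has_bochner_integral (Pi\<^sub>M (\<Union>j\<in>{..<length ms}. layer_scope L (ms ! j) \<inter> Z) M)
      (\<lambda>z. \<Prod>j<length ms. out (ms ! j) (indices L l a ! j) z * cnj (out (ms ! j) (indices L l b ! j) z))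
      (\<Prod>j<length ms. v j)"
  proof (rule has_bochner_integral_PiM_prod)
    have "layer_scope L (ms ! i) \<inter> layer_scope L (ms ! j) = {}"
      if "i < length ms" "j < length ms" "i \<noteq> j" for i j
      using decomp assms(1,2) that ms unfolding decomposable_def Let_def by blast
    then show "disjoint_family_on (\<lambda>j. layer_scope L (ms ! j) \<inter> Z) {..<length ms}"
      by (fastforce simp: disjoint_family_on_def)
    show "finite (layer_scope L (ms ! j) \<inter> Z)" for j
      using Z finite_subset by blast
    show "out (ms ! j) (indices L l a ! j) z * cnj (out (ms ! j) (indices L l b ! j) z) =
          out (ms ! j) (indices L l a ! j) z' * cnj (out (ms ! j) (indices L l b ! j) z')"
      if "j \<in> {..<length ms}" "\<And>i. i \<in> layer_scope L (ms ! j) \<inter> Z \<Longrightarrow> z i = z' i" for j z z'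
    proof -
      have "out (ms ! j) k z = out (ms ! j) k z'" for k
        by (rule out_cong[OF m]) (use that in auto)
      then show ?thesis by simp
    qed
  qed (use inputs in \<open>auto simp: has_gram_def\<close>)
  moreover have "(\<Union>j\<in>{..<length ms}. layer_scope L (ms ! j) \<inter> Z) = layer_scope L l \<inter> Z"
    using scope_inputs[OF assms(1) product_inputs_nonempty[OF assms(1,2)]] ms
    by (auto simp: set_conv_nth)
  moreover have "out l a z * cnj (out l b z) = (\<Prod>j<length ms.
      out (ms ! j) (indices L l a ! j) z * cnj (out (ms ! j) (indices L l b ! j) z))" for z
    using index_layer_out_product[OF assms(1,2,3)] index_layer_out_product[OF assms(1,2,4)] ms
    by (simp add: out_def prod.distrib)
  ultimately show ?thesis
    by (simp add: has_gram_def)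
qed

text \<open>A sum layer has the scope of its input, hence the same measure; expanding both sums and
  using linearity gives the entry of \<open>W G W\<^sup>\<dagger>\<close>.\<close>

lemma has_gram_sum:
  assumes "l < length L" "L ! l = SumLayer K m" "a < K" "b < K"
    and inputs: "\<And>i j. i < layer_width L m \<Longrightarrow> j < layer_width L m \<Longrightarrow> has_gram m i j (v i j)"
  shows "has_gram l a b (\<Sum>i<layer_width L m. \<Sum>j<layer_width L m.
    weight c l $$ (a, i) * v i j * cnj (weight c l $$ (b, j)))"
proof -
  let ?W = "weight c l" and ?n = "layer_width L m"
  have "has_bochner_integral (Pi\<^sub>M (layer_scope L m \<inter> Z) M)
      (\<lambda>z. \<Sum>i<?n. \<Sum>j<?n. ?W $$ (a, i) * (out m i z * cnj (out m j z)) * cnj (?W $$ (b, j)))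
      (\<Sum>i<?n. \<Sum>j<?n. ?W $$ (a, i) * v i j * cnj (?W $$ (b, j)))"
    using inputs unfolding has_gram_def
    by (intro has_bochner_integral_sum has_bochner_integral_mult_left
        has_bochner_integral_mult_right) auto
  moreover have "layer_scope L l = layer_scope L m"
    using scope_inputs[OF assms(1)] assms(2) by simp
  moreover have "out l a z * cnj (out l b z) =
      (\<Sum>i<?n. \<Sum>j<?n. ?W $$ (a, i) * (out m i z * cnj (out m j z)) * cnj (?W $$ (b, j)))" for z
    using index_layer_out_sum[OF assms(1,2,3)] index_layer_out_sum[OF assms(1,2,4)]
    by (simp add: out_def sum_product mult_ac)
  ultimately show ?thesis
    by (simp add: has_gram_def)
qed

text \<open>Integrability propagates from the input layers upwards. This turns the rules for
  \<open>has_gram\<close> into recursion equations for \<open>gram\<close>.\<close>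

lemma has_gram:
  "l < length L \<Longrightarrow> a < layer_width L l \<Longrightarrow> b < layer_width L l \<Longrightarrow> has_gram l a b (gram l a b)"
proof (induction l arbitrary: a b rule: less_induct)
  case (less l)
  \<comment> \<open>Any value suffices, since \<open>has_gramD\<close> identifies it with
    \<open>gram\<close>.\<close>
  have "\<exists>v. has_gram l a b v"
  proof (cases "is_product (L ! l)")
    case True
    let ?ms = "inputs_of (L ! l)"
    have "has_gram (?ms ! j) (indices L l a ! j) (indices L l b ! j)
        (gram (?ms ! j) (indices L l a ! j) (indices L l b ! j))" if "j < length ?ms" for j
      using that less.prems True layer(2,3)[OF less.prems(1)]
      by (intro less.IH indices_less) auto
    then have "has_gram l a b (\<Prod>j<length ?ms.
        gram (?ms ! j) (indices L l a ! j) (indices L l b ! j))"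
      by (rule has_gram_product[OF less.prems(1) True less.prems(2,3) refl])
    then show ?thesis ..
  next
    case False
    then consider i K where "L ! l = InputLayer i K" | K m where "L ! l = SumLayer K m"
      by (cases "L ! l") auto
    then show ?thesis
    proof cases
      case (1 i K)
      then show ?thesis
        using has_gram_input[OF less.prems(1) 1, of a b] has_gram_observed[OF less.prems(1), of a b]
          less.prems(2,3) width_input[OF 1] scope_input[OF 1]
        by (cases "i \<in> Z") auto
    next
      case (2 K m)
      have "has_gram m i j (gram m i j)" if "i < layer_width L m" "j < layer_width L m" for i j
        using that 2 layer(2,3)[OF less.prems(1)] by (intro less.IH) auto
      then show ?thesis
        using has_gram_sum[OF less.prems(1) 2, of a b] less.prems(2,3) width_sum[OF 2] by auto
    qed
  qed
  then show ?case
    using has_gramD by blast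
qed

lemma gram_observed:
  assumes "l < length L" "layer_scope L l \<inter> Z = {}"
  shows "gram l a b = layer_out c y l $ a * cnj (layer_out c y l $ b)"
  using has_gram_observed[OF assms] by (rule has_gramD)

lemma gram_product:
  assumes "l < length L" "is_product (L ! l)" "a < layer_width L l" "b < layer_width L l"
  shows "gram l a b = (\<Prod>j<length (inputs_of (L ! l)).
    gram (inputs_of (L ! l) ! j) (indices L l a ! j) (indices L l b ! j))"
  by (intro has_gramD has_gram_product[OF assms refl] has_gram indices_less assms)
     (use layer(3)[OF assms(1)] in auto)

lemma gram_sum:
  assumes "l < length L" "L ! l = SumLayer K m" "a < K" "b < K"
  shows "gram l a b = (\<Sum>i<layer_width L m. \<Sum>j<layer_width L m.
    weight c l $$ (a, i) * gram m i j * cnj (weight c l $$ (b, j)))"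
  by (intro has_gramD has_gram_sum[OF assms] has_gram)
     (use layer(3)[OF assms(1)] assms(2) in auto)

lemma semi_unitary:
  assumes "l < length L" "L ! l = SumLayer K m" "a < K" "b < K"
  shows "(\<Sum>i<layer_width L m. weight c l $$ (a, i) * cnj (weight c l $$ (b, i))) =
    (if a = b then 1 else 0)"
proof -
  let ?W = "weight c l"
  have W: "?W \<in> carrier_mat K (layer_width L m)"
    by (rule weight_carrier[OF assms(1,2)])
  have "?W * mat_adjoint ?W = 1\<^sub>m K"
    using orthonormal assms(1,2) unfolding orthonormal_circuit_def by blast
  then have "(?W * mat_adjoint ?W) $$ (a, b) = (if a = b then 1 else 0)"
    using assms(3,4) by simp
  moreover have "(?W * mat_adjoint ?W) $$ (a, b) =
      (\<Sum>i<layer_width L m. ?W $$ (a, i) * cnj (?W $$ (b, i)))"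
    using W assms(3,4)
    by (auto simp: mat_adjoint_def scalar_prod_def mat_of_rows_def atLeast0LessThan intro!: sum.cong)
  ultimately show ?thesis by simp
qed

text \<open>For a product layer, the product of Kronecker deltas is 1 exactly if the index lists
  agree, that is, if the entries agree. For a sum layer, \<open>W G W\<^sup>\<dagger>\<close> with
  the identity for \<open>G\<close> is \<open>W W\<^sup>\<dagger>\<close>, the identity by
  semi-unitarity.\<close>

lemma gram_integrated_out:
  "l < length L \<Longrightarrow> layer_scope L l \<subseteq> Z \<Longrightarrow> a < layer_width L l \<Longrightarrow> b < layer_width L l \<Longrightarrow>
    gram l a b = (if a = b then 1 else 0)"
proof (induction l arbitrary: a b rule: less_induct)
  case (less l)
  have m: "m < l" "m < length L" "layer_scope L m \<subseteq> Z" if "m \<in> set (inputs_of (L ! l))" for m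
    using that layer(2,3)[OF less.prems(1)] scope_mono[OF less.prems(1)] less.prems(2) by blast+
  show ?case
  proof (cases "is_product (L ! l)")
    case True
    let ?ms = "inputs_of (L ! l)"
    have "gram l a b = (\<Prod>j<length ?ms. if indices L l a ! j = indices L l b ! j then 1 else 0)"
      unfolding gram_product[OF less.prems(1) True less.prems(3,4)]
      by (intro prod.cong refl less.IH m indices_less less.prems True) auto
    also have "\<dots> = (if \<forall>j<length ?ms. indices L l a ! j = indices L l b ! j then 1 else 0)"
      by (auto intro: prod.neutral simp: prod_zero_iff)
    also have "(\<forall>j<length ?ms. indices L l a ! j = indices L l b ! j) \<longleftrightarrow> a = b"
      using indices_eq_iff[OF less.prems(1) True less.prems(3,4)] True
      by (simp add: list_eq_iff_nth_eq)
    finally show ?thesis .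
  next
    case False
    then consider i K where "L ! l = InputLayer i K" | K m where "L ! l = SumLayer K m"
      by (cases "L ! l") auto
    then show ?thesis
    proof cases
      case (1 i K)
      then show ?thesis
        using has_gram_input[OF less.prems(1) 1, of a b] less.prems(2-4)
          width_input[OF 1] scope_input[OF 1] has_gramD by simp
    next
      case (2 K m)
      have ab: "a < K" "b < K"
        using less.prems(3,4) width_sum[OF 2] by simp_all
      have "gram l a b = (\<Sum>i<layer_width L m. \<Sum>j<layer_width L m.
          weight c l $$ (a, i) * (if i = j then 1 else 0) * cnj (weight c l $$ (b, j)))"
        unfolding gram_sum[OF less.prems(1) 2 ab]
        by (intro sum.cong refl arg_cong2[where f = "(*)"] less.IH m) (use 2 in auto)
      also have "\<dots> = (\<Sum>i<layer_width L m. weight c l $$ (a, i) * cnj (weight c l $$ (b, i)))"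
        by (intro sum.cong refl) (simp add: if_distrib if_distribR cong: if_cong)
      finally show ?thesis
        using semi_unitary[OF less.prems(1) 2 ab] by simp
    qed
  qed
qed

lemma output_layer:
  "length L - 1 < length L" "layer_scope L (length L - 1) = {1..d}" "layer_width L (length L - 1) = 1"
  using valid_layers by (auto simp: valid_layers_def)

text \<open>The output layer has all variables in its scope and width 1, so the diagonal entry of
  its Gram matrix integrates the squared modulus over all of \<open>Z\<close>.\<close>

lemma marginal:
  "integrable (\<Pi>\<^sub>M i\<in>Z. dom_measure (D i)) (squared_modulus c Y Z y)"
  "complex_of_real (marginal D c Y Z y) = gram (length L - 1) 0 0"
proof -
  have PiM: "(\<Pi>\<^sub>M i\<in>Z. dom_measure (D i)) = Pi\<^sub>M Z M"
    using Z by (intro PiM_cong) (auto simp: M_def)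
  have "has_gram (length L - 1) 0 0 (gram (length L - 1) 0 0)"
    by (rule has_gram) (use output_layer in auto)
  moreover have "layer_scope L (length L - 1) \<inter> Z = Z"
    using output_layer(2) Z by auto
  moreover have "out (length L - 1) 0 z * cnj (out (length L - 1) 0 z) =
      complex_of_real (squared_modulus c Y Z y z)" for z
    by (simp add: out_def squared_modulus_def circuit_out_def complex_norm_square del: of_real_power)
  ultimately have *: "has_bochner_integral (Pi\<^sub>M Z M)
      (\<lambda>z. complex_of_real (squared_modulus c Y Z y z)) (gram (length L - 1) 0 0)"
    by (simp add: has_gram_def)
  \<comment> \<open>Gram entries are complex; taking real parts brings integrability back to the
    real integrand.\<close>
  have "integrable (Pi\<^sub>M Z M) (\<lambda>z. Re (complex_of_real (squared_modulus c Y Z y z)))"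
    using * by (intro integrable_Re) (auto simp: has_bochner_integral_iff)
  then show "integrable (\<Pi>\<^sub>M i\<in>Z. dom_measure (D i)) (squared_modulus c Y Z y)"
    by (simp add: PiM)
  show "complex_of_real (marginal D c Y Z y) = gram (length L - 1) 0 0"
    using * by (simp add: has_bochner_integral_iff marginal_def PiM)
qed

end

section \<open>The algorithm\<close>

lemma prod_list_upt: "(\<Prod>j\<leftarrow>[0..<n]. f j) = (\<Prod>j<n. f j :: 'a::comm_monoid_mult)"
  by (induction n) (simp_all add: mult.commute)

lemma sum_list_upt: "(\<Sum>j\<leftarrow>[0..<n]. f j) = (\<Sum>j<n. f j :: 'a::comm_monoid_add)"
  by (simp add: interv_sum_list_conv_sum_set_nat atLeast0LessThan)

text \<open>An input layer is read from the registers \<open>0, ..., K - 1\<close>, where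
  \<open>load\<close> has placed its values.\<close>

definition vec_expr :: "layer list \<Rightarrow> nat \<Rightarrow> nat \<Rightarrow> nat \<Rightarrow> expr" where
  "vec_expr L w l k = (case L ! l of
      InputLayer i K \<Rightarrow> Op (Reg k)
    | SumLayer K m \<Rightarrow> sum_expr (map (\<lambda>j. Times (Op (Weight l k j)) (slot_expr w (Vec m j)))
        [0..<layer_width L m])
    | _ \<Rightarrow> prod_expr (map (\<lambda>j. slot_expr w (Vec (inputs_of (L ! l) ! j) (indices L l k ! j)))
        [0..<length (inputs_of (L ! l))]))"

text \<open>Gram matrices are stored for mixed scopes only. The identity and the rank-one matrices
  are produced entry by entry on demand at constant cost, which keeps observed layers linear in
  their size.\<close>

definition gram_entry :: "layer list \<Rightarrow> nat set \<Rightarrow> nat \<Rightarrow> nat \<Rightarrow> nat \<Rightarrow> nat \<Rightarrow> expr" where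
  "gram_entry L Z w m a b =
    (if layer_scope L m \<subseteq> Z then Op (if a = b then One else Zero)
     else if layer_scope L m \<inter> Z = {} then
       Times (slot_expr w (Vec m a)) (Cnj (slot_expr w (Vec m b)))
     else slot_expr w (Gram m a b))"

definition gram_expr :: "layer list \<Rightarrow> nat set \<Rightarrow> nat \<Rightarrow> nat \<Rightarrow> nat \<Rightarrow> nat \<Rightarrow> expr" where
  "gram_expr L Z w l a b = (case L ! l of
      SumLayer K m \<Rightarrow> sum_expr (map (\<lambda>i. sum_expr (map (\<lambda>j.
          Times (Times (Op (Weight l a i)) (gram_entry L Z w m i j)) (Cnj (Op (Weight l b j))))
        [0..<layer_width L m])) [0..<layer_width L m])
    | _ \<Rightarrow> prod_expr (map (\<lambda>j.
          gram_entry L Z w (inputs_of (L ! l) ! j) (indices L l a ! j) (indices L l b ! j))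
        [0..<length (inputs_of (L ! l))]))"

text \<open>All input layers share one buffer starting at register 0; its content is copied into
  \<open>Vec\<close> slots before the next load.\<close>

definition load :: "layer list \<Rightarrow> nat set \<Rightarrow> nat \<Rightarrow> instr list" where
  "load L Z l = (case L ! l of InputLayer i K \<Rightarrow> if i \<in> Z then [] else [EvalInput 0 l] | _ \<Rightarrow> [])"

definition layer_assigns :: "layer list \<Rightarrow> nat set \<Rightarrow> nat \<Rightarrow> nat \<Rightarrow> (slot \<times> expr) list" where
  "layer_assigns L Z w l =
    (if layer_scope L l \<subseteq> Z then []
     else if layer_scope L l \<inter> Z = {} then
       map (\<lambda>k. (Vec l k, vec_expr L w l k)) [0..<layer_width L l]
     else map (\<lambda>(a, b). (Gram l a b, gram_expr L Z w l a b))
       (List.product [0..<layer_width L l] [0..<layer_width L l]))"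

definition layer_program :: "layer list \<Rightarrow> nat set \<Rightarrow> nat \<Rightarrow> nat \<Rightarrow> instr list" where
  "layer_program L Z w l = load L Z l @ assign w (layer_assigns L Z w l)"

text \<open>If the output scope lies in \<open>Z\<close>, then \<open>Y\<close> is empty, the time
  bound is 0 and not even one instruction may be spent: the answer is the constant
  \<open>One\<close>, the squared norm of the circuit function.\<close>

definition marginal_program :: "layer list \<Rightarrow> nat set \<Rightarrow> program" where
  "marginal_program L Z = (let w = max_layer_size L; o' = length L - 1 in
    if layer_scope L o' \<subseteq> Z then (concat (map (layer_program L Z w) [0..<length L]), One)
    else (concat (map (layer_program L Z w) [0..<length L]) @ assign w [(Out, gram_entry L Z w o' 0 0)],
      Reg (reg w Out)))"

text \<open>The registers that layer \<open>l\<close> may read and must preserve while it stores its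
  results: the input buffer and the slots of earlier layers.\<close>

definition written_before :: "nat \<Rightarrow> nat \<Rightarrow> nat set" where
  "written_before w l = {..<w} \<union> reg w ` ({Vec m k | m k. m < l} \<union> {Gram m a b | m a b. m < l})"

lemma reg_written_before:
  "m < l \<Longrightarrow> reg w (Vec m k) \<in> written_before w l"
  "m < l \<Longrightarrow> reg w (Gram m a b) \<in> written_before w l"
  by (auto simp: written_before_def)

lemma reg_written_before_iff: "reg w \<sigma> \<in> written_before w l \<longleftrightarrow>
    (\<exists>m k. m < l \<and> \<sigma> = Vec m k) \<or> (\<exists>m a b. m < l \<and> \<sigma> = Gram m a b)"
  using reg_ge[of w \<sigma>] by (auto simp: written_before_def)

lemma regs_gram_entry: "m < l \<Longrightarrow> expr_regs (gram_entry L Z w m a b) \<subseteq> written_before w l"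
  by (auto simp: gram_entry_def reg_written_before)

text \<open>The dearest case is an observed layer: two operands, one conjugation and one
  multiplication.\<close>

lemma cost_gram_entry: "expr_cost (gram_entry L Z w m a b) \<le> 4"
  by (auto simp: gram_entry_def)

lemma distinct_layer_assigns: "distinct (map fst (layer_assigns L Z w l))"
proof -
  have inj: "inj (\<lambda>(a, b). Gram l a b)"
    by (auto intro: injI)
  have *: "map fst (map (\<lambda>(a, b). (Gram l a b, f a b)) xs) = map (\<lambda>(a, b). Gram l a b) xs"
    for f :: "nat \<Rightarrow> nat \<Rightarrow> expr" and xs
    by auto
  show ?thesis
    unfolding layer_assigns_def
    by (auto simp: * distinct_map comp_def inj_on_def distinct_product simp del: map_map)
qed

lemma fst_layer_assigns:
  "fst ` set (layer_assigns L Z w l) \<subseteq> {Vec l k | k. True} \<union> {Gram l a b | a b. True}"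
  by (auto simp: layer_assigns_def)

section \<open>Registers read and written by a layer\<close>

context circuit_graph
begin

lemma layer_le_max: "l < length L \<Longrightarrow> layer_size L l \<le> max_layer_size L"
  unfolding max_layer_size_def by (intro Max_ge) auto

text \<open>Hence the block filled by \<open>EvalInput 0 l\<close> stays below all slots, which
  start at the maximal layer size.\<close>

lemma input_width_le:
  assumes "l < length L" "L ! l = InputLayer i K"
  shows "K \<le> max_layer_size L"
  using layer_le_max[OF assms(1)] assms(2) by (simp add: layer_size_def)

lemma regs_vec_expr:
  assumes "l < length L" "k < layer_width L l"
  shows "expr_regs (vec_expr L (max_layer_size L) l k) \<subseteq> written_before (max_layer_size L) l"
proof (cases "L ! l")
  case (InputLayer i K)
  then show ?thesis
    using assms(2) input_width_le[OF assms(1) InputLayer] width_input[OF InputLayer]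
    by (simp add: vec_expr_def written_before_def)
qed (use layer(2)[OF assms(1)] in \<open>auto simp: vec_expr_def reg_written_before\<close>)

lemma regs_gram_expr:
  assumes "l < length L"
  shows "expr_regs (gram_expr L Z w l a b) \<subseteq> written_before w l"
proof (cases "L ! l")
  case (SumLayer K m)
  then have "m < l" using layer(2)[OF assms] by simp
  then show ?thesis
    using regs_gram_entry SumLayer by (auto simp: gram_expr_def) blast
next
  case (HadamardLayer ms)
  then have "ms ! j < l" if "j < length ms" for j
    using layer(2)[OF assms] that by simp
  then show ?thesis
    using regs_gram_entry HadamardLayer by (auto simp: gram_expr_def) blast
next
  case (KroneckerLayer ms)
  then have "ms ! j < l" if "j < length ms" for j
    using layer(2)[OF assms] that by simp
  then show ?thesis
    using regs_gram_entry KroneckerLayer by (auto simp: gram_expr_def) blast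
qed (simp add: gram_expr_def)

lemma regs_layer_assigns:
  assumes "l < length L" "x \<in> set (layer_assigns L Z (max_layer_size L) l)"
  shows "expr_regs (snd x) \<subseteq> written_before (max_layer_size L) l"
  using assms(2) regs_vec_expr[OF assms(1)] regs_gram_expr[OF assms(1)]
  by (fastforce simp: layer_assigns_def split: if_splits)

text \<open>A layer reads only the buffer and earlier slots and writes only its own slots and the
  stack, so its assignments act simultaneously.\<close>

lemma fold_layer_assigns:
  assumes "l < length L"
  defines "w \<equiv> max_layer_size L"
  shows "(\<sigma>, e) \<in> set (layer_assigns L Z w l) \<Longrightarrow>
      fold (exec c y) (assign w (layer_assigns L Z w l)) s (reg w \<sigma>) = expr_val c s e"
    and "r \<in> written_before w l \<Longrightarrow>
      fold (exec c y) (assign w (layer_assigns L Z w l)) s r = s r"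
proof -
  let ?xs = "layer_assigns L Z w l"
  have slots: "fst ` set ?xs \<subseteq> {Vec l k | k. True} \<union> {Gram l a b | a b. True}"
    by (rule fst_layer_assigns)
  then have temp: "fst ` set ?xs \<inter> range Temp = {}"
    by auto
  have disj: "written_before w l \<inter> reg w ` (range Temp \<union> fst ` set ?xs) = {}"
    using slots by (auto simp: reg_written_before_iff)
  then have regs: "\<forall>x\<in>set ?xs. expr_regs (snd x) \<inter> reg w ` (range Temp \<union> fst ` set ?xs) = {}"
    using regs_layer_assigns[OF assms(1)] unfolding w_def by blast
  show "(\<sigma>, e) \<in> set ?xs \<Longrightarrow> fold (exec c y) (assign w ?xs) s (reg w \<sigma>) = expr_val c s e"
    by (rule fold_assign(1)[OF distinct_layer_assigns temp regs])
  show "r \<in> written_before w l \<Longrightarrow> fold (exec c y) (assign w ?xs) s r = s r"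
    by (rule fold_assign(2)[OF distinct_layer_assigns temp regs]) (use disj in blast)
qed

end

section \<open>Correctness of the program\<close>

context circuit_marginal
begin

abbreviation "w \<equiv> max_layer_size L"

text \<open>The invariant before layer \<open>l\<close> is processed. Layers with scope inside
  \<open>Z\<close> store nothing and impose no condition.\<close>

definition computed :: "nat \<Rightarrow> (nat \<Rightarrow> complex) \<Rightarrow> bool" where
  "computed l s \<longleftrightarrow> (\<forall>m<l.
    (layer_scope L m \<inter> Z = {} \<longrightarrow>
      (\<forall>k<layer_width L m. s (reg w (Vec m k)) = layer_out c y m $ k)) \<and>
    (layer_scope L m \<inter> Z \<noteq> {} \<longrightarrow> \<not> layer_scope L m \<subseteq> Z \<longrightarrow>
      (\<forall>a<layer_width L m. \<forall>b<layer_width L m. s (reg w (Gram m a b)) = gram m a b)))"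

text \<open>Only registers from \<open>w\<close> on have to agree, so that \<open>load\<close> may
  overwrite the buffer.\<close>

lemma computed_cong:
  assumes "computed l s" "\<And>r. r \<in> written_before w l \<Longrightarrow> w \<le> r \<Longrightarrow> s' r = s r"
  shows "computed l s'"
  using assms unfolding computed_def by (simp add: reg_written_before reg_ge)

lemma val_gram_entry:
  assumes "computed l s" "l \<le> length L" "m < l" "a < layer_width L m" "b < layer_width L m"
  shows "expr_val c s (gram_entry L Z w m a b) = gram m a b"
proof -
  have m: "m < length L"
    using assms(2,3) by simp
  consider "layer_scope L m \<subseteq> Z" | "\<not> layer_scope L m \<subseteq> Z" "layer_scope L m \<inter> Z = {}"
    | "\<not> layer_scope L m \<subseteq> Z" "layer_scope L m \<inter> Z \<noteq> {}"
    by blast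
  then show ?thesis
  proof cases
    case 1
    then show ?thesis
      using gram_integrated_out[OF m 1 assms(4,5)] by (simp add: gram_entry_def)
  next
    case 2
    then show ?thesis
      using assms(1,3-5) gram_observed[OF m 2(2)] by (simp add: gram_entry_def computed_def)
  next
    case 3
    then show ?thesis
      using assms(1,3-5) by (simp add: gram_entry_def computed_def)
  qed
qed

lemma val_vec_expr:
  assumes s: "computed l s" and l: "l < length L" "layer_scope L l \<inter> Z = {}" "k < layer_width L l"
    and input: "\<And>i K. L ! l = InputLayer i K \<Longrightarrow> s k = input_fun c l k (y i)"
  shows "expr_val c s (vec_expr L w l k) = layer_out c y l $ k"
proof -
  \<comment> \<open>Inputs of an observed layer are observed too, so the invariant provides their
    output vectors.\<close>
  have m: "s (reg w (Vec m j)) = layer_out c y m $ j"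
    if "m \<in> set (inputs_of (L ! l))" "j < layer_width L m" for m j
    using s that layer(2)[OF l(1) that(1)] scope_mono[OF l(1) that(1)] l(2)
    unfolding computed_def by blast
  show ?thesis
  proof (cases "is_product (L ! l)")
    case True
    let ?ms = "inputs_of (L ! l)"
    have "expr_val c s (vec_expr L w l k) =
        (\<Prod>j<length ?ms. s (reg w (Vec (?ms ! j) (indices L l k ! j))))"
      using True by (cases "L ! l") (auto simp: vec_expr_def prod_list_upt comp_def)
    also have "\<dots> = (\<Prod>j<length ?ms. layer_out c y (?ms ! j) $ (indices L l k ! j))"
      by (intro prod.cong refl m indices_less l True) auto
    finally show ?thesis
      using index_layer_out_product[OF l(1) True l(3)] by simp
  next
    case False
    then consider i K where "L ! l = InputLayer i K" | K m where "L ! l = SumLayer K m"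
      by (cases "L ! l") auto
    then show ?thesis
    proof cases
      case (1 i K)
      then show ?thesis
        using input[OF 1] l(3) width_input[OF 1] by (simp add: vec_expr_def layer_out_input)
    next
      case (2 K m')
      have "expr_val c s (vec_expr L w l k) =
          (\<Sum>j<layer_width L m'. weight c l $$ (k, j) * s (reg w (Vec m' j)))"
        using 2 by (simp add: vec_expr_def sum_list_upt comp_def)
      also have "\<dots> = (\<Sum>j<layer_width L m'. weight c l $$ (k, j) * layer_out c y m' $ j)"
        using m 2 by simp
      finally show ?thesis
        using index_layer_out_sum[OF l(1) 2] l(3) width_sum[OF 2] by simp
    qed
  qed
qed

lemma val_gram_expr:
  assumes s: "computed l s" and l: "l < length L" "layer_scope L l \<inter> Z \<noteq> {}" "\<not> layer_scope L l \<subseteq> Z"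
    and ab: "a < layer_width L l" "b < layer_width L l"
  shows "expr_val c s (gram_expr L Z w l a b) = gram l a b"
proof -
  have m: "expr_val c s (gram_entry L Z w m i j) = gram m i j"
    if "m \<in> set (inputs_of (L ! l))" "i < layer_width L m" "j < layer_width L m" for m i j
    using l(1) layer(2)[OF l(1) that(1)] that by (intro val_gram_entry[OF s]) auto
  show ?thesis
  proof (cases "is_product (L ! l)")
    case True
    let ?ms = "inputs_of (L ! l)"
    have "expr_val c s (gram_expr L Z w l a b) = (\<Prod>j<length ?ms.
        expr_val c s (gram_entry L Z w (?ms ! j) (indices L l a ! j) (indices L l b ! j)))"
      using True by (cases "L ! l") (auto simp: gram_expr_def prod_list_upt comp_def)
    also have "\<dots> = (\<Prod>j<length ?ms. gram (?ms ! j) (indices L l a ! j) (indices L l b ! j))"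
      by (intro prod.cong refl m indices_less l True ab) auto
    finally show ?thesis
      using gram_product[OF l(1) True ab] by simp
  next
    case False
    \<comment> \<open>The scope of an input layer is a single variable and cannot be mixed.\<close>
    moreover have "L ! l \<noteq> InputLayer i K" for i K
      using l(2,3) scope_input[of l i K] by auto
    ultimately obtain K m' where 2: "L ! l = SumLayer K m'"
      by (cases "L ! l") auto
    have "expr_val c s (gram_expr L Z w l a b) = (\<Sum>i<layer_width L m'. \<Sum>j<layer_width L m'.
        weight c l $$ (a, i) * expr_val c s (gram_entry L Z w m' i j) * cnj (weight c l $$ (b, j)))"
      using 2 by (simp add: gram_expr_def sum_list_upt comp_def)
    also have "\<dots> = (\<Sum>i<layer_width L m'. \<Sum>j<layer_width L m'.
        weight c l $$ (a, i) * gram m' i j * cnj (weight c l $$ (b, j)))"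
      using m 2 by simp
    finally show ?thesis
      using gram_sum[OF l(1) 2] ab width_sum[OF 2] by simp
  qed
qed

lemma computed_layer_program:
  assumes s: "computed l s" and l: "l < length L"
  shows "computed (Suc l) (fold (exec c y) (layer_program L Z w l) s)"
proof -
  define s1 where "s1 = fold (exec c y) (load L Z l) s"
  define s2 where "s2 = fold (exec c y) (assign w (layer_assigns L Z w l)) s1"
  \<comment> \<open>Loading changes at most the first \<open>K\<close> registers, and
    \<open>K \<le> w\<close>.\<close>
  have "s1 r = s r" if "w \<le> r" for r
    using that input_width_le[OF l] by (auto simp: s1_def load_def split: layer.split)
  then have s1: "computed l s1"
    by (intro computed_cong[OF s]) auto
  have input: "s1 k = input_fun c l k (y i)" if "L ! l = InputLayer i K" "i \<notin> Z" "k < K" for i K k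
    using that by (simp add: s1_def load_def)
  have "computed l s2"
    unfolding s2_def by (rule computed_cong[OF s1]) (rule fold_layer_assigns(2)[OF l])
  moreover have "s2 (reg w (Vec l k)) = layer_out c y l $ k"
    if "layer_scope L l \<inter> Z = {}" "k < layer_width L l" for k
  proof -
    have "(Vec l k, vec_expr L w l k) \<in> set (layer_assigns L Z w l)"
      using that scope(1)[OF l] by (auto simp: layer_assigns_def)
    then have "s2 (reg w (Vec l k)) = expr_val c s1 (vec_expr L w l k)"
      unfolding s2_def by (rule fold_layer_assigns(1)[OF l])
    also have "\<dots> = layer_out c y l $ k"
      using that input scope_input width_input by (intro val_vec_expr s1 l) auto
    finally show ?thesis .
  qed
  moreover have "s2 (reg w (Gram l a b)) = gram l a b"
    if "layer_scope L l \<inter> Z \<noteq> {}" "\<not> layer_scope L l \<subseteq> Z" "a < layer_width L l" "b < layer_width L l"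
    for a b
  proof -
    have "(Gram l a b, gram_expr L Z w l a b) \<in> set (layer_assigns L Z w l)"
      using that by (auto simp: layer_assigns_def)
    then have "s2 (reg w (Gram l a b)) = expr_val c s1 (gram_expr L Z w l a b)"
      unfolding s2_def by (rule fold_layer_assigns(1)[OF l])
    also have "\<dots> = gram l a b"
      using that by (intro val_gram_expr s1 l) auto
    finally show ?thesis .
  qed
  ultimately show ?thesis
    unfolding layer_program_def by (auto simp: computed_def less_Suc_eq s1_def s2_def)
qed

lemma computed_all:
  "l \<le> length L \<Longrightarrow>
    computed l (fold (exec c y) (concat (map (layer_program L Z w) [0..<l])) (\<lambda>_. 0))"
proof (induction l)
  case 0
  then show ?case by (simp add: computed_def)
next
  case (Suc l)
  then show ?case
    using computed_layer_program by simp
qed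

lemma run_marginal_program:
  "run (marginal_program L Z) c y = complex_of_real (marginal D c Y Z y)"
proof -
  let ?o = "length L - 1"
  define s where "s = fold (exec c y) (concat (map (layer_program L Z w) [0..<length L])) (\<lambda>_. 0)"
  have s: "computed (length L) s"
    unfolding s_def by (rule computed_all) simp
  have "run (marginal_program L Z) c y = gram ?o 0 0"
  proof (cases "layer_scope L ?o \<subseteq> Z")
    case True
    then show ?thesis
      using gram_integrated_out[OF output_layer(1) True, of 0 0] output_layer(3)
      by (simp add: marginal_program_def run_def)
  next
    case False
    let ?e = "gram_entry L Z w ?o 0 0"
    have "expr_regs ?e \<inter> reg w ` (range Temp \<union> {Out}) = {}"
      using regs_gram_entry[of ?o "length L" L Z w 0 0] output_layer(1)
      by (fastforce simp: reg_written_before_iff)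
    then have "fold (exec c y) (assign w [(Out, ?e)]) s (reg w Out) = expr_val c s ?e"
      by (intro fold_assign(1)) auto
    also have "\<dots> = gram ?o 0 0"
      using output_layer by (intro val_gram_entry[OF s]) auto
    finally show ?thesis
      using False by (simp add: marginal_program_def run_def s_def Let_def)
  qed
  then show ?thesis
    by (simp add: marginal(2))
qed

end

section \<open>Operation counts\<close>

lemma sum_list_le_bound:
  assumes "\<And>x. x \<in> set xs \<Longrightarrow> f x \<le> B"
  shows "(\<Sum>x\<leftarrow>xs. f x) \<le> length xs * (B :: nat)"
  using assms by (induction xs) (auto intro!: add_mono)

lemma sum_list_concat_map: "(\<Sum>I\<leftarrow>concat (map f xs). g I) = (\<Sum>x\<leftarrow>xs. \<Sum>I\<leftarrow>f x. g I :: nat)"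
  by (induction xs) auto

context circuit_graph
begin

text \<open>With the final copy, an entry costs \<open>2 * N + 2\<close> for a product with
  \<open>N\<close> inputs and \<open>4 * n + 2\<close> for a sum over an input of width
  \<open>n\<close>; positivity of \<open>N\<close> and \<open>n\<close> gives the factor 6. The
  smaller factor 2 for input layers leaves room for \<open>EvalInput\<close>.\<close>

lemma cost_vec_expr:
  assumes "l < length L"
  shows "layer_width L l * (expr_cost (vec_expr L w l k) + 1) \<le>
    (case L ! l of InputLayer i K \<Rightarrow> 2 | _ \<Rightarrow> 6) * layer_size L l"
proof -
  have N: "1 \<le> length (inputs_of (L ! l))" if "is_product (L ! l)"
    using product_inputs_nonempty[OF assms that] by (cases "inputs_of (L ! l)") auto
  show ?thesis
  proof (cases "L ! l")
    case (InputLayer i K)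
    then show ?thesis
      by (simp add: vec_expr_def layer_size_def width_input)
  next
    case (HadamardLayer ms)
    then have "expr_cost (vec_expr L w l k) + 1 \<le> 6 * length ms"
      using N by (simp add: vec_expr_def sum_list_triv comp_def)
    then have "layer_width L l * (expr_cost (vec_expr L w l k) + 1) \<le> layer_width L l * (6 * length ms)"
      by (rule mult_left_mono) simp
    also have "\<dots> = 6 * layer_size L l"
      using HadamardLayer by (simp add: layer_size_def)
    finally show ?thesis
      using HadamardLayer by simp
  next
    case (KroneckerLayer ms)
    then have "expr_cost (vec_expr L w l k) + 1 \<le> 6 * length ms"
      using N by (simp add: vec_expr_def sum_list_triv comp_def)
    then have "layer_width L l * (expr_cost (vec_expr L w l k) + 1) \<le> layer_width L l * (6 * length ms)"
      by (rule mult_left_mono) simp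
    also have "\<dots> = 6 * layer_size L l"
      using KroneckerLayer by (simp add: layer_size_def)
    finally show ?thesis
      using KroneckerLayer by simp
  next
    case (SumLayer K m)
    then have "1 \<le> layer_width L m"
      using width_pos[of m] layer(3)[OF assms] by simp
    then have "expr_cost (vec_expr L w l k) + 1 \<le> 6 * layer_width L m"
      using SumLayer by (simp add: vec_expr_def sum_list_triv comp_def)
    then have "layer_width L l * (expr_cost (vec_expr L w l k) + 1) \<le> layer_width L l * (6 * layer_width L m)"
      by (rule mult_left_mono) simp
    also have "\<dots> = 6 * layer_size L l"
      using SumLayer by (simp add: layer_size_def width_sum)
    finally show ?thesis
      using SumLayer by simp
  qed
qed

text \<open>The size is the width times the number \<open>N\<close> of inputs or times the input
  width \<open>n\<close>. An entry costs at most \<open>5 * N + 2\<close> for a product and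
  \<open>10 * n\<^sup>2 + 2 * n + 2\<close> for a sum, the copy included; the latter gives
  14.\<close>

lemma cost_gram_expr:
  assumes "l < length L" "inputs_of (L ! l) \<noteq> []"
  shows "(layer_width L l)\<^sup>2 * (expr_cost (gram_expr L Z w l a b) + 1) \<le> 14 * (layer_size L l)\<^sup>2"
proof (cases "is_product (L ! l)")
  case True
  let ?N = "length (inputs_of (L ! l))"
  have N: "1 \<le> ?N"
    using assms(2) by (cases "inputs_of (L ! l)") auto
  have "expr_cost (gram_expr L Z w l a b) = (\<Sum>j\<leftarrow>[0..<?N].
      expr_cost (gram_entry L Z w (inputs_of (L ! l) ! j) (indices L l a ! j) (indices L l b ! j)) + 1) + 1"
    using True by (cases "L ! l") (simp_all add: gram_expr_def comp_def)
  also have "\<dots> \<le> length [0..<?N] * 5 + 1"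
    by (intro add_mono sum_list_le_bound order.refl) (use cost_gram_entry in \<open>simp add: le_diff_conv\<close>)
  finally have "expr_cost (gram_expr L Z w l a b) + 1 \<le> 14 * ?N"
    using N by simp
  also have "\<dots> \<le> 14 * ?N\<^sup>2"
    using N by (simp add: power2_eq_square)
  finally have "(layer_width L l)\<^sup>2 * (expr_cost (gram_expr L Z w l a b) + 1) \<le>
      (layer_width L l)\<^sup>2 * (14 * ?N\<^sup>2)"
    by (rule mult_left_mono) simp
  also have "\<dots> = 14 * (layer_size L l)\<^sup>2"
    using True by (cases "L ! l") (simp_all add: layer_size_def power_mult_distrib)
  finally show ?thesis .
next
  case False
  then obtain K m where Km: "L ! l = SumLayer K m"
    using assms(2) by (cases "L ! l") auto
  let ?n = "layer_width L m"
  have n: "1 \<le> ?n"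
    using width_pos[of m] layer(3)[OF assms(1)] Km by simp
  have "expr_cost (gram_expr L Z w l a b) =
      (\<Sum>i\<leftarrow>[0..<?n]. (\<Sum>j\<leftarrow>[0..<?n]. expr_cost (gram_entry L Z w m i j) + 6) + 2) + 1"
    using Km by (simp add: gram_expr_def comp_def numeral_eq_Suc)
  also have "\<dots> \<le> length [0..<?n] * (length [0..<?n] * 10 + 2) + 1"
    by (intro add_mono sum_list_le_bound order.refl) (use cost_gram_entry in \<open>simp add: le_diff_conv\<close>)
  finally have "expr_cost (gram_expr L Z w l a b) + 1 \<le> 10 * ?n\<^sup>2 + 2 * ?n + 2"
    by (simp add: power2_eq_square algebra_simps)
  also have "\<dots> \<le> 14 * ?n\<^sup>2"
    using n le_square[of ?n] unfolding power2_eq_square by linarith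
  finally have "K\<^sup>2 * (expr_cost (gram_expr L Z w l a b) + 1) \<le> K\<^sup>2 * (14 * ?n\<^sup>2)"
    by (rule mult_left_mono) simp
  then show ?thesis
    using Km by (simp add: width_sum layer_size_def power_mult_distrib mult_ac)
qed

lemma cost_layer_program:
  assumes "l < length L"
  shows "(\<Sum>I\<leftarrow>layer_program L Z w l. instr_cost L I) \<le>
    (if layer_scope L l \<subseteq> Z then 0
     else if layer_scope L l \<inter> Z = {} then 6 * max_layer_size L
     else 14 * (max_layer_size L)\<^sup>2)"
proof -
  \<comment> \<open>An input layer that meets \<open>Z\<close> is over a variable of
    \<open>Z\<close> and is never evaluated.\<close>
  have load_nil: "load L Z l = []" if "layer_scope L l \<inter> Z \<noteq> {}"
    using that scope_input[of l] by (auto simp: load_def split: layer.split)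
  consider "layer_scope L l \<subseteq> Z" | "\<not> layer_scope L l \<subseteq> Z" "layer_scope L l \<inter> Z = {}"
    | "\<not> layer_scope L l \<subseteq> Z" "layer_scope L l \<inter> Z \<noteq> {}"
    by blast
  then show ?thesis
  proof cases
    case 1
    then have "layer_scope L l \<inter> Z \<noteq> {}"
      using scope(1)[OF assms] by auto
    then show ?thesis
      using 1 load_nil by (simp add: layer_program_def layer_assigns_def time_assign)
  next
    case 2
    \<comment> \<open>The cost of \<open>vec_expr\<close> does not depend on the entry, so that of
      entry 0 serves as \<open>B\<close>.\<close>
    obtain B where B: "\<And>k. expr_cost (vec_expr L w l k) + 1 \<le> B"
        "layer_width L l * B \<le> (case L ! l of InputLayer i K \<Rightarrow> 2 | _ \<Rightarrow> 6) * layer_size L l"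
    proof
      show "expr_cost (vec_expr L w l k) + 1 \<le> expr_cost (vec_expr L w l 0) + 1" for k
        by (cases "L ! l") (simp_all add: vec_expr_def comp_def)
    qed (rule cost_vec_expr[OF assms])
    have "(\<Sum>I\<leftarrow>assign w (layer_assigns L Z w l). instr_cost L I) =
        (\<Sum>k\<leftarrow>[0..<layer_width L l]. expr_cost (vec_expr L w l k) + 1)"
      using 2 by (simp add: time_assign layer_assigns_def comp_def)
    also have "\<dots> \<le> length [0..<layer_width L l] * B"
      by (rule sum_list_le_bound) (rule B(1))
    also have "\<dots> \<le> (case L ! l of InputLayer i K \<Rightarrow> 2 | _ \<Rightarrow> 6) * layer_size L l"
      using B(2) by simp
    finally have "(\<Sum>I\<leftarrow>layer_program L Z w l. instr_cost L I) \<le> 6 * layer_size L l"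
      by (cases "L ! l") (auto simp: layer_program_def load_def layer_size_def)
    then show ?thesis
      using 2 layer_le_max[OF assms] by simp
  next
    case 3
    then have inputs: "inputs_of (L ! l) \<noteq> []"
      using inputs_empty_iff[OF assms] scope_input by auto
    have "(\<Sum>I\<leftarrow>layer_program L Z w l. instr_cost L I) =
        (\<Sum>p\<leftarrow>List.product [0..<layer_width L l] [0..<layer_width L l].
          expr_cost (gram_expr L Z w l (fst p) (snd p)) + 1)"
      using 3 load_nil
      by (simp add: layer_program_def layer_assigns_def time_assign comp_def case_prod_unfold)
    also have "\<dots> \<le> length (List.product [0..<layer_width L l] [0..<layer_width L l]) *
        (14 * (layer_size L l)\<^sup>2 div (layer_width L l)\<^sup>2)"
    \<comment> \<open>The bound per entry is the total bound divided by the number of entries, which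
      is positive.\<close>
    proof (rule sum_list_le_bound)
      show "expr_cost (gram_expr L Z w l (fst p) (snd p)) + 1 \<le>
          14 * (layer_size L l)\<^sup>2 div (layer_width L l)\<^sup>2" for p
        using cost_gram_expr[OF assms inputs, of Z w "fst p" "snd p"] width_pos[OF assms]
        by (simp add: less_eq_div_iff_mult_less_eq mult.commute)
    qed
    also have "\<dots> \<le> 14 * (layer_size L l)\<^sup>2"
      using times_div_less_eq_dividend[of "(layer_width L l)\<^sup>2" "14 * (layer_size L l)\<^sup>2"]
      by (simp add: power2_eq_square)
    also have "\<dots> \<le> 14 * (max_layer_size L)\<^sup>2"
      using layer_le_max[OF assms] by (simp add: power_mono)
    finally show ?thesis
      using 3 by simp
  qed
qed

text \<open>Layer 0 has no earlier layer to read from, so it is an input layer and has positive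
  width.\<close>

lemma max_layer_size_pos: "0 < max_layer_size L"
proof -
  have "0 < length L"
    using valid_layers by (auto simp: valid_layers_def)
  moreover from this obtain i K where "L ! 0 = InputLayer i K"
    using layer(2)[of 0] inputs_empty_iff[of 0] by (metis less_nat_zero_code list.set_sel(1))
  ultimately show ?thesis
    using layer(1)[of 0] input_width_le[of 0 i K] by simp
qed

text \<open>The constant is 14 + 5: at most 14 for every layer by \<open>cost_layer_program\<close>,
  and at most 5 operations to deliver the result.\<close>

lemma time_marginal_program:
  assumes Z: "Z \<subseteq> {1..d}" and Y: "Y = {1..d} - Z"
  shows "time L (marginal_program L Z) \<le> 19 *
    (card (layers_in L Y) * max_layer_size L + card (layers_across L Y Z) * (max_layer_size L)\<^sup>2)"
proof -
  let ?S = "max_layer_size L" and ?o = "length L - 1"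
  have o: "?o < length L"
    using valid_layers by (auto simp: valid_layers_def)
  have in_iff: "l \<in> layers_in L Y \<longleftrightarrow> layer_scope L l \<inter> Z = {}" if "l < length L" for l
    using scope(2)[OF that] that Y by (auto simp: layers_in_def)
  have across_iff: "l \<in> layers_across L Y Z \<longleftrightarrow>
      \<not> layer_scope L l \<subseteq> Z \<and> layer_scope L l \<inter> Z \<noteq> {}" if "l < length L" for l
    using scope(2)[OF that] that Y by (auto simp: layers_across_def)
  have subset: "layers_in L Y \<subseteq> {..<length L}" "layers_across L Y Z \<subseteq> {..<length L}"
    by (auto simp: layers_in_def layers_across_def)
  then have fin: "finite (layers_in L Y)" "finite (layers_across L Y Z)"
    using finite_subset by blast+
  have "(\<Sum>I\<leftarrow>concat (map (layer_program L Z ?S) [0..<length L]). instr_cost L I) =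
      (\<Sum>l<length L. \<Sum>I\<leftarrow>layer_program L Z ?S l. instr_cost L I)"
    by (simp add: sum_list_concat_map sum_list_upt)
  also have "\<dots> \<le> (\<Sum>l<length L. (if l \<in> layers_in L Y then 6 * ?S else 0) +
      (if l \<in> layers_across L Y Z then 14 * ?S\<^sup>2 else 0))"
    using scope(1) by (intro sum_mono order.trans[OF cost_layer_program]) (auto simp: in_iff across_iff)
  also have "\<dots> = card (layers_in L Y) * (6 * ?S) + card (layers_across L Y Z) * (14 * ?S\<^sup>2)"
    using subset by (simp add: sum.distrib sum.inter_restrict[symmetric] Int_absorb1 Int_absorb2)
  finally have main: "(\<Sum>I\<leftarrow>concat (map (layer_program L Z ?S) [0..<length L]). instr_cost L I) \<le>
      6 * (card (layers_in L Y) * ?S) + 14 * (card (layers_across L Y Z) * ?S\<^sup>2)"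
    by simp
  show ?thesis
  proof (cases "layer_scope L ?o \<subseteq> Z")
    case True
    then show ?thesis
      using main by (simp add: marginal_program_def time_def Let_def)
  next
    case False
    \<comment> \<open>The output layer itself is counted in one of the two sets, so the bracket is
      at least 1 and absorbs the final operations.\<close>
    then have "?o \<in> layers_in L Y \<or> ?o \<in> layers_across L Y Z"
      using in_iff[OF o] across_iff[OF o] by blast
    then have "1 \<le> card (layers_in L Y) \<or> 1 \<le> card (layers_across L Y Z)"
      using fin by (auto simp: Suc_le_eq card_gt_0_iff)
    then have "1 \<le> card (layers_in L Y) * ?S + card (layers_across L Y Z) * ?S\<^sup>2"
      using max_layer_size_pos by (auto simp: Suc_le_eq)
    moreover have "time L (marginal_program L Z) \<le>
        (\<Sum>I\<leftarrow>concat (map (layer_program L Z ?S) [0..<length L]). instr_cost L I) + 5"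
      using False cost_gram_entry[of L Z ?S ?o 0 0]
      by (simp add: marginal_program_def time_def Let_def time_assign)
    ultimately show ?thesis
      using main by simp
  qed
qed

end

section \<open>Correctness and cost combined\<close>

theorem theorem1:
  shows "\<exists>(algorithm :: layer list \<Rightarrow> nat set \<Rightarrow> program) (C :: nat).
    \<forall>(d :: nat) (D :: nat \<Rightarrow> 'v domain) (c :: 'v circuit) (Y :: nat set) (Z :: nat set) y.
      (\<forall>i\<in>{1..d}. valid_domain (D i)) \<longrightarrow>
      valid_circuit d c \<longrightarrow>
      structured_decomposable d (layers c) \<longrightarrow>
      orthonormal_circuit D c \<longrightarrow>
      Z \<subseteq> {1..d} \<longrightarrow>
      Y = {1..d} - Z \<longrightarrow>
      y \<in> (\<Pi>\<^sub>E i\<in>Y. dom_set (D i)) \<longrightarrow>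
        integrable (\<Pi>\<^sub>M i\<in>Z. dom_measure (D i)) (squared_modulus c Y Z y) \<and>
        run (algorithm (layers c) Z) c y = complex_of_real (marginal D c Y Z y) \<and>
        time (layers c) (algorithm (layers c) Z)
          \<le> C * (card (layers_in (layers c) Y) * max_layer_size (layers c) +
                 card (layers_across (layers c) Y Z) * (max_layer_size (layers c))\<^sup>2)"
proof (intro exI allI impI)
  fix d :: nat and D :: "nat \<Rightarrow> 'v domain" and c :: "'v circuit" and Y Z :: "nat set" and y
  assume A: "\<forall>i\<in>{1..d}. valid_domain (D i)" "valid_circuit d c"
    "structured_decomposable d (layers c)" "orthonormal_circuit D c" "Z \<subseteq> {1..d}" "Y = {1..d} - Z"
  interpret circuit_marginal d c D Y Z y
    using A by unfold_locales (simp_all add: structured_decomposable_def)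
  \<comment> \<open>The witnesses \<open>marginal_program\<close> and 19 are supplied here by
    unification. They cannot depend on the circuit fixed above, so the constant is uniform and the
    program sees only the graph and \<open>Z\<close>.\<close>
  show "integrable (\<Pi>\<^sub>M i\<in>Z. dom_measure (D i)) (squared_modulus c Y Z y) \<and>
      run (marginal_program (layers c) Z) c y = complex_of_real (marginal D c Y Z y) \<and>
      time (layers c) (marginal_program (layers c) Z)
        \<le> 19 * (card (layers_in (layers c) Y) * max_layer_size (layers c) +
          card (layers_across (layers c) Y Z) * (max_layer_size (layers c))\<^sup>2)"
    using marginal(1) run_marginal_program time_marginal_program[OF A(5,6)] by blast
qed

end
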